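(* Let $H_n$, $n\in\mathbb N$, be Hilbert spaces, let $e=(e^{(n)})_{n\in\mathbb N}$ with $e^{(n)}\in H_n$, $\|e^{(n)}\|=1$, be a stabilizing sequence, and for each $n$ let $\{V_j^{(n)}\}_{j\in\mathbb Z}$ be closed subspaces of $H_n$ such that: (a) $V_j^{(n)}\subset V_{j+1}^{(n)}$ for all $j\in\mathbb Z$ and $n\in\mathbb N$; (b) $\bigcup_{j\in\mathbb Z}V_j^{(n)}$ is dense in $H_n$; (c) $\bigcap_{j\in\mathbb Z}V_j^{(n)}=\{0\}$. For $m\in\mathbb N$ and $j\in\mathbb Z$ put $V_j^{[m]}=\Big(\bigotimes_{k=1}^mV_j^{(k)}\Big)\otimes e^{(m+1)}\otimes e^{(m+2)}\otimes\cdots$ and $V_j=\overline{\mathrm{span}}\,(V_j^{[m]}:m\in\mathbb N)$. Then the subspaces $V_j$, $j\in\mathbb Z$, of $\mathcal H_e=\bigotimes_{e,n\in\mathbb N}H_n$ satisfy: (aH) $V_j\subset V_{j+1}$ for all $j\in\mathbb Z$; (bH) $\bigcup_{j\in\mathbb Z}V_j$ is dense in $\mathcal H_e$; (cH) $\bigcap_{j\in\mathbb Z}V_j=\{0\}$.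
   Context: Hilbert spaces are separable. Infinite tensor product: choose an orthonormal basis $(e^{(n)}_k)_{k}$ of $H_n$ with $e^{(n)}_1=e^{(n)}$; $\mathcal H_e=\bigotimes_{e,n\in\mathbb N}H_n$ is the Hilbert space with orthonormal basis all formal products $e^{(1)}_{\alpha_1}\otimes e^{(2)}_{\alpha_2}\otimes\cdots$ with $\alpha_n=1$ for all sufficiently large $n$. Vectors $f_1\otimes\cdots\otimes f_m\otimes e^{(m+1)}\otimes e^{(m+2)}\otimes\cdots$ are defined by multilinearity and continuity, and the finite Hilbert tensor product $\bigotimes_{k=1}^mH_k$ (and its closed subspaces $\bigotimes_{k=1}^mV_j^{(k)}$, completed tensor product) is isometrically embedded in $\mathcal H_e$ by $u\mapsto u\otimes e^{(m+1)}\otimes e^{(m+2)}\otimes\cdots$. *)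

theory Defs
  imports "HOL-Analysis.Analysis" "HOL-Library.Function_Algebras"
begin

section \<open>Scalars\<close>

text \<open>
  The scalar field is the real or the complex field. The two axioms force
  scnj x = |x|^2 / x for x \<noteq> 0, so scnj is the identity on the reals and the usual
  conjugation on the complex numbers (and, by the Gelfand--Mazur theorem, there are no other
  models).
\<close>

class rc_field = real_normed_field + banach +
  fixes scnj :: "'a \<Rightarrow> 'a"
  assumes scnj_add: "scnj (x + y) = scnj x + scnj y"
    and mult_scnj_scaleR: "x * scnj x = (norm x)\<^sup>2 *\<^sub>R 1"

instantiation real :: rc_field
begin
definition scnj_real :: "real \<Rightarrow> real" where "scnj_real x = x"
instance by standard (simp_all add: scnj_real_def power2_eq_square)
end

instantiation complex :: rc_field
begin
definition scnj_complex :: "complex \<Rightarrow> complex" where "scnj_complex x = cnj x"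
instance by standard
  (simp_all add: scnj_complex_def scaleR_conv_of_real complex_norm_square del: of_real_power)
end

lemma mult_scnj: "x * scnj x = (of_real ((norm x)\<^sup>2) :: 'k::rc_field)"
  by (simp only: mult_scnj_scaleR of_real_def)

lemma scnj_0 [simp]: "scnj (0::'k::rc_field) = 0"
  using scnj_add[of "0::'k" 0] by simp

lemma norm_scnj [simp]: "norm (scnj (x::'k::rc_field)) = norm x"
proof (cases "x = 0")
  case False
  have "norm x * norm (scnj x) = norm x * norm x"
    by (metis mult_scnj norm_mult norm_of_real power2_eq_square abs_of_nonneg zero_le_power2)
  with False show ?thesis by simp
qed simp

lemma scnj_eq_divide: "x \<noteq> 0 \<Longrightarrow> scnj (x::'k::rc_field) = of_real ((norm x)\<^sup>2) / x"
  using mult_scnj[of x] by (simp add: field_simps)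

lemma scnj_mult: "scnj (x * y) = scnj x * scnj (y::'k::rc_field)"
  by (cases "x = 0 \<or> y = 0")
    (auto simp: scnj_eq_divide norm_mult power_mult_distrib)

lemma scnj_of_real [simp]: "scnj (of_real r :: 'k::rc_field) = of_real r"
  by (cases "r = 0") (auto simp: scnj_eq_divide power2_eq_square)

lemma scnj_scnj [simp]: "scnj (scnj x) = (x::'k::rc_field)"
proof (cases "x = 0")
  case False
  then have "scnj x \<noteq> 0" by (metis norm_scnj norm_eq_zero)
  have "scnj x * scnj (scnj x) = scnj x * x"
    by (metis mult_scnj mult.commute norm_scnj)
  with \<open>scnj x \<noteq> 0\<close> show ?thesis by simp
qed simp

lemma scnj_diff: "scnj (x - y) = scnj x - scnj (y::'k::rc_field)"
  by (metis add_diff_cancel diff_add_cancel scnj_add)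

lemma bounded_linear_scnj: "bounded_linear (scnj :: 'k::rc_field \<Rightarrow> 'k)"
proof (rule bounded_linear_intro[where K = 1])
  show "scnj (r *\<^sub>R x) = r *\<^sub>R scnj x" for r and x :: 'k
    by (simp add: scaleR_conv_of_real scnj_mult)
qed (simp_all add: scnj_add)


section \<open>Hilbert spaces on a carrier\<close>

text \<open>
  A Hilbert space is a linear subspace S of some ambient vector space, with an inner product
  ip that is only meaningful on S. Since every family of vector spaces embeds into its direct
  sum, any family of Hilbert spaces over the same scalars can be given in this form over one
  ambient vector space; the inner products of the members are unrelated.
\<close>

definition hnorm :: "('a \<Rightarrow> 'a \<Rightarrow> 'k::rc_field) \<Rightarrow> 'a \<Rightarrow> real" where
  "hnorm ip x = sqrt (norm (ip x x))"

text \<open>The value outside S is fixed because the library's metric spaces want a distance that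
  is symmetric everywhere.\<close>

definition hdist :: "'a set \<Rightarrow> ('a \<Rightarrow> 'a \<Rightarrow> 'k::rc_field) \<Rightarrow> 'a::ab_group_add \<Rightarrow> 'a \<Rightarrow> real" where
  "hdist S ip x y = (if x \<in> S \<and> y \<in> S then hnorm ip (x - y) else 0)"

abbreviation htop :: "'a set \<Rightarrow> ('a \<Rightarrow> 'a \<Rightarrow> 'k::rc_field) \<Rightarrow> 'a::ab_group_add topology" where
  "htop S ip \<equiv> Metric_space.mtopology S (hdist S ip)"

locale hilbert_space = vector_space scale
  for scale :: "'k::rc_field \<Rightarrow> 'a::ab_group_add \<Rightarrow> 'a" +
  fixes S :: "'a set" and ip :: "'a \<Rightarrow> 'a \<Rightarrow> 'k"
  assumes subspace_S: "subspace S"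
    and ip_add: "\<lbrakk>x \<in> S; y \<in> S; z \<in> S\<rbrakk> \<Longrightarrow> ip (x + y) z = ip x z + ip y z"
    and ip_scale: "\<lbrakk>x \<in> S; y \<in> S\<rbrakk> \<Longrightarrow> ip (scale c x) y = c * ip x y"
    and ip_scnj: "\<lbrakk>x \<in> S; y \<in> S\<rbrakk> \<Longrightarrow> ip y x = scnj (ip x y)"
    and ip_nonneg: "x \<in> S \<Longrightarrow> ip x x = of_real (norm (ip x x))"
    and ip_definite: "\<lbrakk>x \<in> S; ip x x = 0\<rbrakk> \<Longrightarrow> x = 0"
    and complete: "Metric_space.mcomplete S (hdist S ip)"

context hilbert_space
begin

lemma ip_add_right: "\<lbrakk>x \<in> S; y \<in> S; z \<in> S\<rbrakk> \<Longrightarrow> ip z (x + y) = ip z x + ip z y"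
  by (metis ip_add ip_scnj scnj_add subspace_S subspace_add)

lemma ip_scale_right: "\<lbrakk>x \<in> S; y \<in> S\<rbrakk> \<Longrightarrow> ip y (scale c x) = scnj c * ip y x"
  by (metis ip_scale ip_scnj scnj_mult subspace_S subspace_scale)

lemma hnorm_sq: "x \<in> S \<Longrightarrow> ip x x = of_real ((hnorm ip x)\<^sup>2)"
  using ip_nonneg[of x] by (simp add: hnorm_def)

lemma hnorm_ge_0 [simp]: "0 \<le> hnorm ip x"
  by (simp add: hnorm_def)

lemma hnorm_eq_0_iff: "x \<in> S \<Longrightarrow> hnorm ip x = 0 \<longleftrightarrow> x = 0"
proof -
  have "ip 0 0 = 0"
    using ip_scale[of 0 0 0] subspace_0[OF subspace_S] by simp
  then show "x \<in> S \<Longrightarrow> hnorm ip x = 0 \<longleftrightarrow> x = 0"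
    using ip_definite by (auto simp: hnorm_def)
qed

lemma hnorm_minus: assumes "x \<in> S" shows "hnorm ip (- x) = hnorm ip x"
proof -
  have "scnj (- 1 :: 'k) = - 1" using scnj_of_real[of "- 1"] by (simp del: scnj_of_real)
  moreover have "- x = scale (- 1) x" by simp
  ultimately have "ip (- x) (- x) = ip x x"
    using assms subspace_scale[OF subspace_S, of x "- 1"]
    by (simp only: ip_scale ip_scale_right) simp
  then show ?thesis by (simp add: hnorm_def)
qed

lemma Cauchy_Schwarz:
  assumes x: "x \<in> S" and y: "y \<in> S"
  shows "norm (ip x y) \<le> hnorm ip x * hnorm ip y"
proof (cases "y = 0")
  case True
  have "ip x y = 0"
    using ip_scale_right[OF y x, of 0] True by simp
  then show ?thesis by simp
next
  case False
  define q where "q = (hnorm ip y)\<^sup>2"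
  have q: "q > 0" using False hnorm_eq_0_iff[OF y] by (simp add: q_def)
  have yy: "ip y y = of_real q" using hnorm_sq[OF y] by (simp add: q_def)
  define c where "c = - (ip x y / of_real q)"
  have cS: "scale c y \<in> S" using y subspace_S subspace_scale by blast
  then have zS: "x + scale c y \<in> S" using x subspace_S subspace_add by blast
  have q0: "(of_real q :: 'k) \<noteq> 0" using q by simp
  have sc: "scnj c = - (scnj (ip x y) / of_real q)"
  proof -
    have "c * of_real q = - ip x y" using q0 by (simp add: c_def)
    then have "scnj c * of_real q = scnj (of_real (-1) * ip x y)"
      by (metis scnj_mult scnj_of_real of_real_minus of_real_1 mult_minus1)
    also have "\<dots> = - scnj (ip x y)" by (simp only: scnj_mult scnj_of_real) simp
    finally show ?thesis using q0 by (simp add: field_simps)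
  qed
  have "of_real ((hnorm ip (x + scale c y))\<^sup>2) = ip (x + scale c y) (x + scale c y)"
    using hnorm_sq[OF zS] by simp
  also have "\<dots> = ip x x + scnj c * ip x y + c * scnj (ip x y) + c * scnj c * of_real q"
    using x y cS zS
    by (simp add: ip_add ip_add_right ip_scale ip_scale_right yy ip_scnj[OF x y] algebra_simps)
  also have "\<dots> = of_real ((hnorm ip x)\<^sup>2) - ip x y * scnj (ip x y) / of_real q"
    using q0 unfolding sc c_def hnorm_sq[OF x] by (simp add: field_simps)
  also have "\<dots> = of_real ((hnorm ip x)\<^sup>2 - (norm (ip x y))\<^sup>2 / q)"
    by (simp only: mult_scnj of_real_diff of_real_divide)
  finally have "0 \<le> (hnorm ip x)\<^sup>2 - (norm (ip x y))\<^sup>2 / q"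
    by (metis of_real_eq_iff zero_le_power2)
  then have "(norm (ip x y))\<^sup>2 \<le> (hnorm ip x * hnorm ip y)\<^sup>2"
    using q by (simp add: field_simps q_def power_mult_distrib)
  then show ?thesis
    by (rule power2_le_imp_le) simp
qed

lemma hnorm_triangle:
  assumes x: "x \<in> S" and y: "y \<in> S"
  shows "hnorm ip (x + y) \<le> hnorm ip x + hnorm ip y"
proof -
  have xy: "x + y \<in> S" using x y subspace_S subspace_add by blast
  have n: "norm (ip z z) = (hnorm ip z)\<^sup>2" for z by (simp add: hnorm_def)
  have "ip (x + y) (x + y) = ip x x + ip x y + (ip y x + ip y y)"
    using x y xy by (simp add: ip_add ip_add_right)
  then have "(hnorm ip (x + y))\<^sup>2 \<le> norm (ip x x) + norm (ip x y) + (norm (ip y x) + norm (ip y y))"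
    unfolding n[symmetric] by (metis norm_add_rule_thm norm_triangle_ineq)
  also have "\<dots> \<le> (hnorm ip x + hnorm ip y)\<^sup>2"
    using Cauchy_Schwarz[OF x y] Cauchy_Schwarz[OF y x]
    by (simp add: n power2_sum algebra_simps)
  finally show ?thesis by (rule power2_le_imp_le) simp
qed

end

sublocale hilbert_space \<subseteq> metric: Metric_space S "hdist S ip"
proof
  have d: "x - y \<in> S" if "x \<in> S" "y \<in> S" for x y
    using that subspace_S subspace_diff by blast
  show "0 \<le> hdist S ip x y" for x y by (simp add: hdist_def)
  show "hdist S ip x y = hdist S ip y x" for x y
    using hnorm_minus[OF d, of x y] by (auto simp: hdist_def)
  show "hdist S ip x y = 0 \<longleftrightarrow> x = y" if "x \<in> S" "y \<in> S" for x y
    using that d by (simp add: hdist_def hnorm_eq_0_iff)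
  show "hdist S ip x z \<le> hdist S ip x y + hdist S ip y z"
    if "x \<in> S" "y \<in> S" "z \<in> S" for x y z
    using that hnorm_triangle[OF d d, of x y y z] by (simp add: hdist_def)
qed

definition closed_subspace ::
  "('k::rc_field \<Rightarrow> 'a::ab_group_add \<Rightarrow> 'a) \<Rightarrow> 'a set \<Rightarrow> ('a \<Rightarrow> 'a \<Rightarrow> 'k) \<Rightarrow> 'a set \<Rightarrow> bool" where
  "closed_subspace sc S ip V \<longleftrightarrow> module.subspace sc V \<and> closedin (htop S ip) V"

definition closed_span ::
  "('k::rc_field \<Rightarrow> 'a::ab_group_add \<Rightarrow> 'a) \<Rightarrow> 'a set \<Rightarrow> ('a \<Rightarrow> 'a \<Rightarrow> 'k) \<Rightarrow> 'a set \<Rightarrow> 'a set" where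
  "closed_span sc S ip X = htop S ip closure_of (module.span sc X)"

definition orthonormal_basis ::
  "('k::rc_field \<Rightarrow> 'a::ab_group_add \<Rightarrow> 'a) \<Rightarrow> 'a set \<Rightarrow> ('a \<Rightarrow> 'a \<Rightarrow> 'k)
    \<Rightarrow> 'i set \<Rightarrow> ('i \<Rightarrow> 'a) \<Rightarrow> bool" where
  "orthonormal_basis sc S ip I b \<longleftrightarrow>
     b ` I \<subseteq> S \<and> (\<forall>k\<in>I. \<forall>l\<in>I. ip (b k) (b l) = (if k = l then 1 else 0)) \<and>
     closed_span sc S ip (b ` I) = S"


section \<open>The Hilbert space with a given orthonormal basis\<close>

text \<open>
  The Hilbert space whose orthonormal basis is the (formal) index set A is the space of square
  summable families on A; these are extended by 0 to the whole index type. The basis vector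
  belonging to i is the function that is 1 at i and 0 elsewhere.
\<close>

definition ell2 :: "'i set \<Rightarrow> ('i \<Rightarrow> 'k::rc_field) set" where
  "ell2 A = {f. (\<forall>i. i \<notin> A \<longrightarrow> f i = 0) \<and> (\<lambda>i. (norm (f i))\<^sup>2) summable_on A}"

definition ell2_ip :: "'i set \<Rightarrow> ('i \<Rightarrow> 'k::rc_field) \<Rightarrow> ('i \<Rightarrow> 'k) \<Rightarrow> 'k" where
  "ell2_ip A f g = (\<Sum>\<^sub>\<infinity>i\<in>A. f i * scnj (g i))"

definition fscale :: "'k::rc_field \<Rightarrow> ('i \<Rightarrow> 'k) \<Rightarrow> ('i \<Rightarrow> 'k)" where
  "fscale c f = (\<lambda>i. c * f i)"


lemma vector_space_fscale: "vector_space (fscale :: 'k::rc_field \<Rightarrow> ('i \<Rightarrow> 'k) \<Rightarrow> _)"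
  by unfold_locales (auto simp: fscale_def algebra_simps fun_eq_iff)

lemma ell2_norm_bound:
  fixes f g :: "'i \<Rightarrow> 'k::rc_field"
  shows "(norm (f i + g i))\<^sup>2 \<le> 2 * (norm (f i))\<^sup>2 + 2 * (norm (g i))\<^sup>2"
proof -
  have "(norm (f i + g i))\<^sup>2 \<le> (norm (f i) + norm (g i))\<^sup>2"
    by (simp add: norm_triangle_ineq power_mono)
  also have "\<dots> \<le> 2 * (norm (f i))\<^sup>2 + 2 * (norm (g i))\<^sup>2"
    using sum_squares_bound[of "norm (f i)" "norm (g i)"] by (simp add: power2_sum)
  finally show ?thesis .
qed

lemma ell2_add:
  fixes f g :: "'i \<Rightarrow> 'k::rc_field"
  assumes "f \<in> ell2 A" "g \<in> ell2 A" shows "f + g \<in> ell2 A"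
proof -
  have "(\<lambda>i. 2 * (norm (f i))\<^sup>2 + 2 * (norm (g i))\<^sup>2) summable_on A"
    using assms by (intro summable_on_add summable_on_cmult_right) (auto simp: ell2_def)
  then have "(\<lambda>i. (norm (f i + g i))\<^sup>2) summable_on A"
    by (rule summable_on_comparison_test) (auto intro: ell2_norm_bound)
  then show ?thesis using assms by (auto simp: ell2_def)
qed

lemma ell2_fscale: "f \<in> ell2 A \<Longrightarrow> fscale c f \<in> ell2 A"
  by (auto simp: ell2_def fscale_def norm_mult power_mult_distrib intro!: summable_on_cmult_right)

lemma subspace_ell2: "module.subspace fscale (ell2 A :: ('i \<Rightarrow> 'k::rc_field) set)"
proof -
  interpret vector_space "fscale :: 'k \<Rightarrow> ('i \<Rightarrow> 'k) \<Rightarrow> _" by (rule vector_space_fscale)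
  have "0 \<in> (ell2 A :: ('i \<Rightarrow> 'k) set)" by (simp add: ell2_def)
  then show ?thesis by (intro subspaceI) (auto intro: ell2_add ell2_fscale)
qed

lemma ell2_diff: "f \<in> ell2 A \<Longrightarrow> g \<in> ell2 A \<Longrightarrow> f - g \<in> ell2 A"
  using module.subspace_diff[OF _ subspace_ell2] vector_space_fscale
  by (metis module_iff_vector_space)

lemma ell2_ip_summable:
  fixes f g :: "'i \<Rightarrow> 'k::rc_field"
  assumes "f \<in> ell2 A" "g \<in> ell2 A" shows "(\<lambda>i. f i * scnj (g i)) summable_on A"
proof (rule abs_summable_summable)
  have "(\<lambda>i. (norm (f i))\<^sup>2 + (norm (g i))\<^sup>2) summable_on A"
    using assms by (intro summable_on_add) (auto simp: ell2_def)
  then show "(\<lambda>i. f i * scnj (g i)) abs_summable_on A"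
  proof (rule summable_on_comparison_test)
    fix i
    have "2 * (norm (f i) * norm (g i)) \<le> (norm (f i))\<^sup>2 + (norm (g i))\<^sup>2"
      using sum_squares_bound[of "norm (f i)" "norm (g i)"] by simp
    moreover have "0 \<le> norm (f i) * norm (g i)" by simp
    ultimately show "norm (f i * scnj (g i)) \<le> (norm (f i))\<^sup>2 + (norm (g i))\<^sup>2"
      unfolding norm_mult norm_scnj by linarith
  qed auto
qed

lemma ell2_ip_self:
  fixes f :: "'i \<Rightarrow> 'k::rc_field"
  assumes "f \<in> ell2 A"
  shows "ell2_ip A f f = of_real (\<Sum>\<^sub>\<infinity>i\<in>A. (norm (f i))\<^sup>2)"
proof -
  have "(\<Sum>\<^sub>\<infinity>i\<in>A. (of_real ((norm (f i))\<^sup>2) :: 'k)) = of_real (\<Sum>\<^sub>\<infinity>i\<in>A. (norm (f i))\<^sup>2)"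
    using assms
    by (intro infsumI has_sum_bounded_linear[OF bounded_linear_of_real] has_sum_infsum)
      (simp add: ell2_def)
  then show ?thesis by (simp only: ell2_ip_def mult_scnj)
qed

lemma ell2_hnorm:
  assumes "f \<in> ell2 A"
  shows "hnorm (ell2_ip A) f = sqrt (\<Sum>\<^sub>\<infinity>i\<in>A. (norm (f i))\<^sup>2)"
  using infsum_nonneg[of A "\<lambda>i. (norm (f i))\<^sup>2"]
  by (simp add: hnorm_def ell2_ip_self[OF assms])

lemma ell2_hdist:
  assumes "f \<in> ell2 A" "g \<in> ell2 A"
  shows "hdist (ell2 A) (ell2_ip A) f g = sqrt (\<Sum>\<^sub>\<infinity>i\<in>A. (norm (f i - g i))\<^sup>2)"
  using assms by (simp add: hdist_def ell2_hnorm ell2_diff)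

lemma ell2_definite:
  assumes f: "f \<in> ell2 A" and "ell2_ip A f f = 0" shows "f = 0"
proof -
  have "(\<Sum>\<^sub>\<infinity>i\<in>A. (norm (f i))\<^sup>2) \<le> 0"
    using assms by (simp add: ell2_ip_self)
  then have "(norm (f i))\<^sup>2 = 0" if "i \<in> A" for i
    using f that nonneg_infsum_le_0D[of "\<lambda>i. (norm (f i))\<^sup>2" A i] by (auto simp: ell2_def)
  then show ?thesis using f by (auto simp: ell2_def fun_eq_iff)
qed

lemma ell2_ip_scnj:
  fixes f g :: "'i \<Rightarrow> 'k::rc_field"
  assumes "f \<in> ell2 A" "g \<in> ell2 A" shows "ell2_ip A g f = scnj (ell2_ip A f g)"
  using infsumI[OF has_sum_bounded_linear[OF bounded_linear_scnj
      has_sum_infsum[OF ell2_ip_summable[OF assms]]]]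
  by (simp add: ell2_ip_def scnj_mult mult.commute)

lemma ell2_sum_le_hdist:
  assumes "f \<in> ell2 A" "g \<in> ell2 A" "finite F" "F \<subseteq> A"
  shows "(\<Sum>i\<in>F. (norm (f i - g i))\<^sup>2) \<le> (hdist (ell2 A) (ell2_ip A) f g)\<^sup>2"
proof -
  have "(\<lambda>i. (norm (f i - g i))\<^sup>2) summable_on A"
    using ell2_diff[OF assms(1,2)] by (simp add: ell2_def)
  then have "(\<Sum>i\<in>F. (norm (f i - g i))\<^sup>2) \<le> (\<Sum>\<^sub>\<infinity>i\<in>A. (norm (f i - g i))\<^sup>2)"
    using assms by (intro finite_sum_le_infsum) auto
  then show ?thesis
    by (simp add: ell2_hdist assms infsum_nonneg)
qed

lemma Metric_space_ell2: "Metric_space (ell2 A :: ('i \<Rightarrow> 'k::rc_field) set) (hdist (ell2 A) (ell2_ip A))"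
proof
  let ?d = "hdist (ell2 A) (ell2_ip A) :: ('i \<Rightarrow> 'k) \<Rightarrow> _"
  show "0 \<le> ?d f g" for f g by (simp add: hdist_def hnorm_def)
  show "?d f g = ?d g f" for f g
  proof (cases "f \<in> ell2 A \<and> g \<in> ell2 A")
    case True then show ?thesis by (simp add: ell2_hdist norm_minus_commute)
  qed (auto simp: hdist_def)
  show "?d f g = 0 \<longleftrightarrow> f = g" if "f \<in> ell2 A" "g \<in> ell2 A" for f g
    using that ell2_definite[OF ell2_diff[OF that]]
    by (auto simp: hdist_def hnorm_def ell2_ip_def)
  show "?d f h \<le> ?d f g + ?d g h" if fgh: "f \<in> ell2 A" "g \<in> ell2 A" "h \<in> ell2 A" for f g h
  proof -
    have "(\<Sum>\<^sub>\<infinity>i\<in>A. (norm (f i - h i))\<^sup>2) \<le> (?d f g + ?d g h)\<^sup>2"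
    proof (rule infsum_le_finite_sums)
      show "(\<lambda>i. (norm (f i - h i))\<^sup>2) summable_on A"
        using ell2_diff[of f A h] fgh by (simp add: ell2_def)
      fix F assume F: "finite F" "F \<subseteq> A"
      have "L2_set (\<lambda>i. norm (f i - h i)) F \<le> L2_set (\<lambda>i. norm (f i - g i) + norm (g i - h i)) F"
        by (rule L2_set_mono) (simp_all add: norm_diff_triangle_ineq norm_triangle_le
            norm_diff_triangle_le[OF order_refl order_refl])
      also have "\<dots> \<le> L2_set (\<lambda>i. norm (f i - g i)) F + L2_set (\<lambda>i. norm (g i - h i)) F"
        by (rule L2_set_triangle_ineq)
      also have "\<dots> \<le> ?d f g + ?d g h"
        using ell2_sum_le_hdist[OF fgh(1,2) F] ell2_sum_le_hdist[OF fgh(2,3) F]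
        by (intro add_mono)
          (auto simp: L2_set_def hdist_def hnorm_def intro!: real_le_lsqrt sum_nonneg)
      finally have "L2_set (\<lambda>i. norm (f i - h i)) F \<le> ?d f g + ?d g h" .
      then have "(L2_set (\<lambda>i. norm (f i - h i)) F)\<^sup>2 \<le> (?d f g + ?d g h)\<^sup>2"
        by (rule power_mono) simp
      then show "(\<Sum>i\<in>F. (norm (f i - h i))\<^sup>2) \<le> (?d f g + ?d g h)\<^sup>2"
        by (simp add: L2_set_def sum_nonneg)
    qed
    then have "sqrt (\<Sum>\<^sub>\<infinity>i\<in>A. (norm (f i - h i))\<^sup>2) \<le> ?d f g + ?d g h"
      by (rule real_le_lsqrt[rotated]) (simp_all add: hdist_def hnorm_def)
    then show ?thesis using ell2_hdist[OF fgh(1,3)] by simp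
  qed
qed

lemma mcomplete_ell2:
  "Metric_space.mcomplete (ell2 A :: ('i \<Rightarrow> 'k::rc_field) set) (hdist (ell2 A) (ell2_ip A))"
proof -
  let ?d = "hdist (ell2 A) (ell2_ip A) :: ('i \<Rightarrow> 'k) \<Rightarrow> _"
  interpret Metric_space "ell2 A :: ('i \<Rightarrow> 'k) set" ?d by (rule Metric_space_ell2)
  show ?thesis
    unfolding mcomplete_def
  proof (intro allI impI)
    fix s :: "nat \<Rightarrow> 'i \<Rightarrow> 'k"
    assume "MCauchy s"
    then have sS: "s n \<in> ell2 A" for n by (auto simp: MCauchy_def)
    from \<open>MCauchy s\<close> have C: "\<exists>N. \<forall>n n'. N \<le> n \<longrightarrow> N \<le> n' \<longrightarrow> ?d (s n) (s n') < r" if "r > 0" for r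
      using that by (auto simp: MCauchy_def)
    have "Cauchy (\<lambda>n. s n i)" for i
    proof (cases "i \<in> A")
      case True
      show ?thesis
      proof (rule CauchyI)
        fix r :: real assume "r > 0"
        from C[OF this] obtain N where N: "?d (s n) (s n') < r" if "N \<le> n" "N \<le> n'" for n n'
          by blast
        have "norm (s n i - s n' i) < r" if "N \<le> n" "N \<le> n'" for n n'
        proof -
          have "(norm (s n i - s n' i))\<^sup>2 \<le> (?d (s n) (s n'))\<^sup>2"
            using ell2_sum_le_hdist[OF sS sS, of "{i}" n n'] True by simp
          then have "norm (s n i - s n' i) \<le> ?d (s n) (s n')"
            by (rule power2_le_imp_le) simp
          with N[OF that] show ?thesis by simp
        qed
        then show "\<exists>M. \<forall>m\<ge>M. \<forall>n\<ge>M. norm (s m i - s n i) < r" by blast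
      qed
    next
      case False
      then have "s n i = 0" for n using sS[of n] by (simp add: ell2_def)
      then show ?thesis by (simp add: Cauchy_def)
    qed
    then have "\<forall>i. \<exists>l. (\<lambda>n. s n i) \<longlonglongrightarrow> l"
      using Cauchy_convergent by (auto simp: convergent_def)
    then obtain l where l: "(\<lambda>n. s n i) \<longlonglongrightarrow> l i" for i by metis
    have l0: "l i = 0" if "i \<notin> A" for i
    proof -
      have "s n i = 0" for n using sS[of n] that by (simp add: ell2_def)
      then show ?thesis using l[of i] by (simp add: LIMSEQ_const_iff)
    qed
    have fin: "\<exists>N. \<forall>n\<ge>N. \<forall>F. finite F \<and> F \<subseteq> A \<longrightarrow> (\<Sum>i\<in>F. (norm (l i - s n i))\<^sup>2) \<le> r\<^sup>2"
      if "r > 0" for r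
    proof -
      from C[OF that] obtain N where N: "?d (s n) (s n') < r" if "N \<le> n" "N \<le> n'" for n n'
        by blast
      have "(\<Sum>i\<in>F. (norm (l i - s n i))\<^sup>2) \<le> r\<^sup>2" if n: "n \<ge> N" and F: "finite F" "F \<subseteq> A" for n F
      proof (rule LIMSEQ_le_const2)
        show "(\<lambda>m. \<Sum>i\<in>F. (norm (s m i - s n i))\<^sup>2) \<longlonglongrightarrow> (\<Sum>i\<in>F. (norm (l i - s n i))\<^sup>2)"
          by (intro tendsto_intros l)
        have "(\<Sum>i\<in>F. (norm (s m i - s n i))\<^sup>2) \<le> r\<^sup>2" if "m \<ge> N" for m
        proof -
          have "(?d (s m) (s n))\<^sup>2 \<le> r\<^sup>2"
            using N[OF that n] by (intro power_mono) auto
          with ell2_sum_le_hdist[OF sS sS F, of m n] show ?thesis by linarith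
        qed
        then show "\<exists>M. \<forall>m\<ge>M. (\<Sum>i\<in>F. (norm (s m i - s n i))\<^sup>2) \<le> r\<^sup>2" by blast
      qed
      then show ?thesis by blast
    qed
    have diffS: "l - s n \<in> ell2 A"
      if "\<And>F. finite F \<Longrightarrow> F \<subseteq> A \<Longrightarrow> (\<Sum>i\<in>F. (norm (l i - s n i))\<^sup>2) \<le> r\<^sup>2" for n r
    proof -
      have "(\<lambda>i. (norm (l i - s n i))\<^sup>2) summable_on A"
        using that by (intro nonneg_bdd_above_summable_on) (auto intro!: bdd_aboveI2)
      then show ?thesis using l0 sS[of n] by (auto simp: ell2_def)
    qed
    have lS: "l \<in> ell2 A"
    proof -
      from fin[of 1] obtain n where
        "\<And>F. finite F \<Longrightarrow> F \<subseteq> A \<Longrightarrow> (\<Sum>i\<in>F. (norm (l i - s n i))\<^sup>2) \<le> 1\<^sup>2"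
        by auto
      from ell2_add[OF diffS[OF this] sS[of n]] show ?thesis by (simp add: plus_fun_def fun_diff_def)
    qed
    have "limitin mtopology s l sequentially"
      unfolding limit_metric_sequentially
    proof (intro conjI allI impI lS)
      fix r :: real assume r: "r > 0"
      from fin[of "r / 2"] r obtain N where
        N: "\<And>n F. n \<ge> N \<Longrightarrow> finite F \<Longrightarrow> F \<subseteq> A \<Longrightarrow> (\<Sum>i\<in>F. (norm (l i - s n i))\<^sup>2) \<le> (r / 2)\<^sup>2"
        by auto
      have "?d (s n) l < r" if n: "n \<ge> N" for n
      proof -
        have "(\<Sum>\<^sub>\<infinity>i\<in>A. (norm (l i - s n i))\<^sup>2) \<le> (r / 2)\<^sup>2"
          using diffS[OF N[OF n]] N[OF n] by (intro infsum_le_finite_sums) (auto simp: ell2_def)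
        then have "?d l (s n) \<le> r / 2"
          unfolding ell2_hdist[OF lS sS] using r by (intro real_le_lsqrt) auto
        with r show ?thesis by (simp add: commute)
      qed
      then show "\<exists>N. \<forall>n\<ge>N. s n \<in> ell2 A \<and> ?d (s n) l < r" using sS by blast
    qed
    then show "\<exists>x. limitin mtopology s x sequentially" by blast
  qed
qed

theorem hilbert_space_ell2:
  "hilbert_space fscale (ell2 A :: ('i \<Rightarrow> 'k::rc_field) set) (ell2_ip A)"
proof -
  interpret vector_space "fscale :: 'k \<Rightarrow> ('i \<Rightarrow> 'k) \<Rightarrow> _" by (rule vector_space_fscale)
  show ?thesis
  proof
    fix f g h :: "'i \<Rightarrow> 'k" and c :: 'k
    show "subspace (ell2 A :: ('i \<Rightarrow> 'k) set)" by (rule subspace_ell2)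
    show "ell2_ip A (f + g) h = ell2_ip A f h + ell2_ip A g h"
      if "f \<in> ell2 A" "g \<in> ell2 A" "h \<in> ell2 A"
      using infsum_add[OF ell2_ip_summable ell2_ip_summable, of f A h g h] that
      by (simp add: ell2_ip_def distrib_right)
    show "ell2_ip A (fscale c f) g = c * ell2_ip A f g"
      by (simp add: ell2_ip_def fscale_def mult.assoc infsum_cmult_right')
    show "ell2_ip A g f = scnj (ell2_ip A f g)" if "f \<in> ell2 A" "g \<in> ell2 A"
      using that by (rule ell2_ip_scnj)
    show "ell2_ip A f f = of_real (norm (ell2_ip A f f))" if "f \<in> ell2 A"
      using that by (simp add: ell2_ip_self infsum_nonneg)
    show "f = 0" if "f \<in> ell2 A" "ell2_ip A f f = 0"
      using that by (rule ell2_definite)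
    show "Metric_space.mcomplete (ell2 A :: ('i \<Rightarrow> 'k) set) (hdist (ell2 A) (ell2_ip A))"
      by (rule mcomplete_ell2)
  qed
qed

theorem orthonormal_basis_ell2:
  "orthonormal_basis fscale (ell2 A :: ('i \<Rightarrow> 'k::rc_field) set) (ell2_ip A) A
     (\<lambda>i j. if j = i then 1 else 0)"
proof -
  interpret hilbert_space fscale "ell2 A :: ('i \<Rightarrow> 'k) set" "ell2_ip A"
    by (rule hilbert_space_ell2)
  let ?u = "\<lambda>i j. (if j = i then 1 else 0) :: 'k"
  have uS: "?u i \<in> ell2 A" if "i \<in> A" for i
  proof -
    have "(\<lambda>j. (norm (?u i j))\<^sup>2) summable_on A"
      by (rule summable_on_cong_neutral[THEN iffD1, OF _ _ _ summable_on_finite[of "{i}"]])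
        (use that in auto)
    then show ?thesis using that by (auto simp: ell2_def)
  qed
  have "ell2_ip A (?u i) (?u k) = (if i = k then 1 else 0)" if "i \<in> A" for i k
  proof -
    have "ell2_ip A (?u i) (?u k) = (\<Sum>\<^sub>\<infinity>j\<in>{i}. ?u i j * scnj (?u k j))"
      unfolding ell2_ip_def by (rule infsum_cong_neutral) (use that in auto)
    then show ?thesis using scnj_of_real[of 1, where 'k = 'k] by auto
  qed
  moreover have "f \<in> closed_span fscale (ell2 A) (ell2_ip A) (?u ` A)" if f: "f \<in> ell2 A" for f
    unfolding closed_span_def metric.metric_closure_of
  proof (clarsimp simp: f)
    fix r :: real assume r: "r > 0"
    let ?N = "\<lambda>i. (norm (f i))\<^sup>2"
    have sm: "?N summable_on A" using f by (simp add: ell2_def)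
    obtain F where F: "finite F" "F \<subseteq> A" "dist (sum ?N F) (infsum ?N A) \<le> r\<^sup>2 / 2"
      using infsum_finite_approximation[OF sm, of "r\<^sup>2 / 2"] r by auto
    define g where "g = (\<Sum>i\<in>F. fscale (f i) (?u i))"
    have gsp: "g \<in> span (?u ` A)"
      unfolding g_def using F by (intro span_sum span_scale span_base) auto
    have gS: "g \<in> ell2 A"
      unfolding g_def using F by (intro subspace_sum[OF subspace_S] ell2_fscale uS) auto
    have gj: "g j = (if j \<in> F then f j else 0)" for j
    proof -
      have "g j = (\<Sum>i\<in>F. fscale (f i) (?u i) j)"
        unfolding g_def by (induction F rule: infinite_finite_induct) auto
      also have "\<dots> = (\<Sum>i\<in>F. if i = j then f j else 0)"
        by (rule sum.cong) (auto simp: fscale_def)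
      finally show ?thesis using F(1) by simp
    qed
    have "(\<Sum>\<^sub>\<infinity>i\<in>A. (norm (f i - g i))\<^sup>2) = infsum ?N (A - F)"
      by (rule infsum_cong_neutral) (auto simp: gj)
    also have "\<dots> = infsum ?N A - sum ?N F"
      using infsum_Diff[OF sm summable_on_finite[OF F(1)] F(2)] F(1) by simp
    also have "\<dots> \<le> r\<^sup>2 / 2" using F(3) unfolding dist_real_def by linarith
    also have "\<dots> < r\<^sup>2" using r by simp
    finally have "hdist (ell2 A) (ell2_ip A) f g < r"
      using r by (simp add: ell2_hdist[OF f gS] real_less_lsqrt)
    with gsp gS show "\<exists>y\<in>span (?u ` A). y \<in> ell2 A \<and> hdist (ell2 A) (ell2_ip A) f y < r"
      by blast
  qed
  moreover have "closed_span fscale (ell2 A) (ell2_ip A) (?u ` A) \<subseteq> ell2 A"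
    unfolding closed_span_def using closure_of_subset_topspace[of metric.mtopology] by simp
  ultimately show ?thesis
    unfolding orthonormal_basis_def using uS by blast
qed


section \<open>Tensor products\<close>

text \<open>
  Factors, basis vectors and tensor slots are counted from 0. The family b n of vectors
  indexed by I n \<subseteq> \<nat> is an orthonormal basis of the n-th factor, with b n 0 the stabilizing
  vector. A finite product b 0 \<alpha>0 \<otimes> ... \<otimes> b (m-1) \<alpha>(m-1) is represented by its extensional
  multi-index \<alpha> on {..<m}, an infinite one by \<alpha> itself.
\<close>

definition fin_idx :: "(nat \<Rightarrow> nat set) \<Rightarrow> nat \<Rightarrow> (nat \<Rightarrow> nat) set" where
  "fin_idx I m = PiE {..<m} I"

definition inf_idx :: "(nat \<Rightarrow> nat set) \<Rightarrow> (nat \<Rightarrow> nat) set" where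
  "inf_idx I = {\<alpha>. (\<forall>n. \<alpha> n \<in> I n) \<and> (\<forall>\<^sub>F n in sequentially. \<alpha> n = 0)}"

text \<open>The tensor f 0 \<otimes> ... \<otimes> f (m-1), by expanding every factor in its basis.\<close>

definition elem_tensor ::
  "(nat \<Rightarrow> 'a \<Rightarrow> 'a \<Rightarrow> 'k::rc_field) \<Rightarrow> (nat \<Rightarrow> nat set) \<Rightarrow> (nat \<Rightarrow> nat \<Rightarrow> 'a)
    \<Rightarrow> nat \<Rightarrow> (nat \<Rightarrow> 'a) \<Rightarrow> (nat \<Rightarrow> nat) \<Rightarrow> 'k" where
  "elem_tensor ip I b m f =
     (\<lambda>\<alpha>. if \<alpha> \<in> fin_idx I m then \<Prod>k<m. ip k (f k) (b k (\<alpha> k)) else 0)"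

lemma elem_tensor_basis:
  assumes "\<And>n. orthonormal_basis sc (H n) (ip n) (I n) (b n)" and "\<alpha> \<in> fin_idx I m"
  shows "elem_tensor ip I b m (\<lambda>k. b k (\<alpha> k)) = (\<lambda>\<beta>. if \<beta> = \<alpha> then 1 else 0)"
proof
  fix \<beta>
  show "elem_tensor ip I b m (\<lambda>k. b k (\<alpha> k)) \<beta> = (if \<beta> = \<alpha> then 1 else 0)"
  proof (cases "\<beta> \<in> fin_idx I m")
    case True
    have "ip k (b k (\<alpha> k)) (b k (\<beta> k)) = (if \<alpha> k = \<beta> k then 1 else 0)" if "k < m" for k
      using assms True that by (auto simp: orthonormal_basis_def fin_idx_def PiE_def Pi_def)
    then have "elem_tensor ip I b m (\<lambda>k. b k (\<alpha> k)) \<beta> = (\<Prod>k<m. if \<alpha> k = \<beta> k then 1 else 0)"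
      using True by (simp add: elem_tensor_def)
    moreover have "\<beta> = \<alpha>" if "\<forall>k<m. \<alpha> k = \<beta> k"
      using that True assms(2) unfolding fin_idx_def by (intro PiE_ext[of \<beta>]) auto
    ultimately show ?thesis by (auto simp: prod_zero_iff)
  next
    case False
    then show ?thesis using assms(2) by (auto simp: elem_tensor_def)
  qed
qed

text \<open>The completed tensor product W 0 \<otimes> ... \<otimes> W (m-1) of closed subspaces.\<close>

definition tensor_subspace ::
  "(nat \<Rightarrow> 'a \<Rightarrow> 'a \<Rightarrow> 'k::rc_field) \<Rightarrow> (nat \<Rightarrow> nat set) \<Rightarrow> (nat \<Rightarrow> nat \<Rightarrow> 'a)
    \<Rightarrow> nat \<Rightarrow> (nat \<Rightarrow> 'a set) \<Rightarrow> ((nat \<Rightarrow> nat) \<Rightarrow> 'k) set" where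
  "tensor_subspace ip I b m W =
     closed_span fscale (ell2 (fin_idx I m)) (ell2_ip (fin_idx I m))
       {elem_tensor ip I b m f | f. \<forall>k<m. f k \<in> W k}"

text \<open>
  The embedding u \<mapsto> u \<otimes> b m 0 \<otimes> b (m+1) 0 \<otimes> ...: it sends the basis vector \<alpha> of the
  finite product to the multi-index that continues \<alpha> by zeros.
\<close>

definition tensor_embed ::
  "(nat \<Rightarrow> nat set) \<Rightarrow> nat \<Rightarrow> ((nat \<Rightarrow> nat) \<Rightarrow> 'k::rc_field) \<Rightarrow> (nat \<Rightarrow> nat) \<Rightarrow> 'k" where
  "tensor_embed I m u =
     (\<lambda>\<alpha>. if \<alpha> \<in> inf_idx I \<and> (\<forall>n\<ge>m. \<alpha> n = 0) then u (restrict \<alpha> {..<m}) else 0)"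

lemma tensor_embed_isometry:
  assumes I0: "\<And>n. 0 \<in> I n"
  shows "ell2_ip (inf_idx I) (tensor_embed I m u) (tensor_embed I m v) = ell2_ip (fin_idx I m) u v"
proof -
  let ?T = "{\<alpha> \<in> inf_idx I. \<forall>n\<ge>m. \<alpha> n = 0}"
  have bij: "bij_betw (\<lambda>\<alpha>. restrict \<alpha> {..<m}) ?T (fin_idx I m)"
  proof (rule bij_betw_byWitness[where f' = "\<lambda>\<alpha> n. if n < m then \<alpha> n else 0"])
    have "(\<lambda>n. if n < m then \<alpha> n else 0) \<in> inf_idx I" if "\<alpha> \<in> fin_idx I m" for \<alpha>
      using that I0 by (auto simp: inf_idx_def fin_idx_def PiE_def Pi_def
          eventually_sequentially intro!: exI[of _ m])
    then show "(\<lambda>\<alpha> n. if n < m then \<alpha> n else 0) ` fin_idx I m \<subseteq> ?T" by auto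
  qed (auto simp: inf_idx_def fin_idx_def fun_eq_iff PiE_def extensional_def restrict_def)
  have "ell2_ip (inf_idx I) (tensor_embed I m u) (tensor_embed I m v) =
      (\<Sum>\<^sub>\<infinity>\<alpha>\<in>?T. u (restrict \<alpha> {..<m}) * scnj (v (restrict \<alpha> {..<m})))"
    unfolding ell2_ip_def by (rule infsum_cong_neutral) (auto simp: tensor_embed_def)
  also have "\<dots> = ell2_ip (fin_idx I m) u v"
    unfolding ell2_ip_def by (rule infsum_reindex_bij_betw[OF bij])
  finally show ?thesis .
qed

abbreviation inf_tensor :: "(nat \<Rightarrow> nat set) \<Rightarrow> ((nat \<Rightarrow> nat) \<Rightarrow> 'k::rc_field) set" where
  "inf_tensor I \<equiv> ell2 (inf_idx I)"

abbreviation inf_tensor_ip ::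
  "(nat \<Rightarrow> nat set) \<Rightarrow> ((nat \<Rightarrow> nat) \<Rightarrow> 'k::rc_field) \<Rightarrow> ((nat \<Rightarrow> nat) \<Rightarrow> 'k) \<Rightarrow> 'k" where
  "inf_tensor_ip I \<equiv> ell2_ip (inf_idx I)"

definition V_fin ::
  "(nat \<Rightarrow> 'a \<Rightarrow> 'a \<Rightarrow> 'k::rc_field) \<Rightarrow> (nat \<Rightarrow> nat set) \<Rightarrow> (nat \<Rightarrow> nat \<Rightarrow> 'a)
    \<Rightarrow> (nat \<Rightarrow> int \<Rightarrow> 'a set) \<Rightarrow> nat \<Rightarrow> int \<Rightarrow> ((nat \<Rightarrow> nat) \<Rightarrow> 'k) set" where
  "V_fin ip I b V m j = tensor_embed I m ` tensor_subspace ip I b m (\<lambda>k. V k j)"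

definition V_inf ::
  "(nat \<Rightarrow> 'a \<Rightarrow> 'a \<Rightarrow> 'k::rc_field) \<Rightarrow> (nat \<Rightarrow> nat set) \<Rightarrow> (nat \<Rightarrow> nat \<Rightarrow> 'a)
    \<Rightarrow> (nat \<Rightarrow> int \<Rightarrow> 'a set) \<Rightarrow> int \<Rightarrow> ((nat \<Rightarrow> nat) \<Rightarrow> 'k) set" where
  "V_inf ip I b V j =
     closed_span fscale (inf_tensor I) (inf_tensor_ip I) (\<Union>m\<in>{1..}. V_fin ip I b V m j)"

end

theory Submission
  imports Defs
begin

text \<open>
  Nestedness is immediate. For density, an elementary tensor depends continuously on each factor
  (its norm is at most the product of the norms of the factors, by Bessel's inequality), so the
  factors of a basis vector can be moved into the union of the V n j one at a time. For the
  trivial intersection a single factor suffices: fixing all indices but the first one turns a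
  vector of V_inf j into the coordinate family of a vector of V 0 j, and the only vector lying in
  every V 0 j is 0.
\<close>

text \<open>Members of the tensor spaces are coordinate families, whereas the factors are abstract
  Hilbert spaces. The way back from coordinates to a vector of \<open>H 0\<close> is the inequality
  converse to Bessel's, \<open>hnorm_le_if_coordinates\<close>, together with completeness of
  \<open>H 0\<close>; this makes the slice condition survive limits. The vectors \<open>e n\<close>
  need not belong to any \<open>V n j\<close>, so the spaces \<open>V_fin\<close> need not increase
  with \<open>m\<close>, and the bound \<open>m \<ge> 1\<close> matters: the empty product would
  contribute the line through e 0 \<otimes> e 1 \<otimes> ... to every \<open>V_inf j\<close> and
  destroy the trivial intersection. With at least one slot, the first factor is always taken from
  \<open>V 0 j\<close>. For density the tails are exact, being made of stabilizing vectors, so only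
  finitely many slots are ever approximated; nestedness in \<open>j\<close> then provides one level
  for all of them.\<close>

context hilbert_space
begin

section \<open>Elementary geometry of a Hilbert space on a carrier\<close>

lemma diff_in_S: "x \<in> S \<Longrightarrow> y \<in> S \<Longrightarrow> x - y \<in> S"
  using subspace_S subspace_diff by blast

lemma hdist_eq: "x \<in> S \<Longrightarrow> y \<in> S \<Longrightarrow> hdist S ip x y = hnorm ip (x - y)"
  by (simp add: hdist_def)

lemma hnorm_scale: "x \<in> S \<Longrightarrow> hnorm ip (scale c x) = norm c * hnorm ip x"
  using subspace_scale[OF subspace_S, of x c]
  by (simp add: hnorm_def ip_scale ip_scale_right norm_mult real_sqrt_mult)

lemma ip_zero_left [simp]: "y \<in> S \<Longrightarrow> ip 0 y = 0"
  using ip_scale[of y y 0] by simp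

lemma ip_zero_right [simp]: "y \<in> S \<Longrightarrow> ip y 0 = 0"
  using ip_scale_right[of y y 0] by simp

lemma ip_diff: "x \<in> S \<Longrightarrow> y \<in> S \<Longrightarrow> z \<in> S \<Longrightarrow> ip (x - y) z = ip x z - ip y z"
  using ip_add[of "x - y" y z] diff_in_S[of x y] by simp

lemma ip_sum_right:
  "finite F \<Longrightarrow> (\<And>i. i \<in> F \<Longrightarrow> g i \<in> S) \<Longrightarrow> x \<in> S \<Longrightarrow> ip x (\<Sum>i\<in>F. g i) = (\<Sum>i\<in>F. ip x (g i))"
  by (induction F rule: finite_induct) (simp_all add: ip_add_right subspace_sum[OF subspace_S])

lemma pythagoras:
  assumes x: "x \<in> S" and y: "y \<in> S" and o: "ip x y = 0"
  shows "(hnorm ip (x + y))\<^sup>2 = (hnorm ip x)\<^sup>2 + (hnorm ip y)\<^sup>2"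
proof -
  have xy: "x + y \<in> S" using x y subspace_S subspace_add by blast
  have "ip y x = 0" using ip_scnj[OF x y] o by simp
  then have "ip (x + y) (x + y) = ip x x + ip y y"
    using x y xy o by (simp add: ip_add ip_add_right)
  then have "(of_real ((hnorm ip (x + y))\<^sup>2) :: 'k) = of_real ((hnorm ip x)\<^sup>2 + (hnorm ip y)\<^sup>2)"
    using hnorm_sq[OF x] hnorm_sq[OF y] hnorm_sq[OF xy] by simp
  then show ?thesis by (simp only: of_real_eq_iff)
qed

section \<open>Closed spans and closed subspaces\<close>

lemma in_closed_span:
  "x \<in> closed_span scale S ip X \<longleftrightarrow>
    x \<in> S \<and> (\<forall>r>0. \<exists>y\<in>span X. y \<in> S \<and> hdist S ip x y < r)"
  unfolding closed_span_def metric.metric_closure_of by auto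

text \<open>Closedness as an approximation property, the form in which it is verified for preimages
  under the embedding and for slice spaces.\<close>

lemma closed_subspace_iff:
  "closed_subspace scale S ip C \<longleftrightarrow> subspace C \<and> C \<subseteq> S \<and>
    (\<forall>x\<in>S. (\<forall>r>0. \<exists>y\<in>C. hdist S ip x y < r) \<longrightarrow> x \<in> C)"
  unfolding closed_subspace_def closure_of_subset_eq[symmetric] metric.metric_closure_of
  by auto blast+

lemma closed_subspaceD:
  assumes "closed_subspace scale S ip C" "x \<in> S"
    and "\<And>r. r > 0 \<Longrightarrow> \<exists>y\<in>C. hdist S ip x y < r"
  shows "x \<in> C"
  using assms by (simp add: closed_subspace_iff)

lemma closed_span_minimal:
  assumes "X \<subseteq> C" "closed_subspace scale S ip C"
  shows "closed_span scale S ip X \<subseteq> C"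
  using assms span_minimal[of X C] unfolding closed_span_def closed_subspace_def
  by (metis closure_of_minimal)

text \<open>Addition and scaling are continuous, so approximants from \<open>U\<close> can be added
  and scaled.\<close>

lemma closed_subspace_closure_of:
  assumes U: "subspace U"
  shows "closed_subspace scale S ip (htop S ip closure_of U)"
  unfolding closed_subspace_def
proof
  show "subspace (htop S ip closure_of U)"
  proof (rule subspaceI)
    show "0 \<in> htop S ip closure_of U"
      using subspace_0[OF U] subspace_0[OF subspace_S] by (simp add: metric.metric_closure_of) force
    fix x y assume "x \<in> htop S ip closure_of U" "y \<in> htop S ip closure_of U"
    then have x: "x \<in> S" "\<And>r. r > 0 \<Longrightarrow> \<exists>x'\<in>U. x' \<in> S \<and> hdist S ip x x' < r"
      and y: "y \<in> S" "\<And>r. r > 0 \<Longrightarrow> \<exists>y'\<in>U. y' \<in> S \<and> hdist S ip y y' < r"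
      by (auto simp: metric.metric_closure_of)
    have "\<exists>z\<in>U. z \<in> S \<and> hdist S ip (x + y) z < r" if "r > 0" for r
    proof -
      have r: "r / 2 > 0" using that by simp
      obtain x' y' where x': "x' \<in> U" "x' \<in> S" "hdist S ip x x' < r / 2"
        and y': "y' \<in> U" "y' \<in> S" "hdist S ip y y' < r / 2"
        using x(2)[OF r] y(2)[OF r] by blast
      have S: "x + y \<in> S" "x' + y' \<in> S" "x' + y' \<in> U"
        using x y x' y' U subspace_S subspace_add by blast+
      have "hnorm ip ((x - x') + (y - y')) \<le> hnorm ip (x - x') + hnorm ip (y - y')"
        using x y x' y' by (intro hnorm_triangle diff_in_S)
      then have "hdist S ip (x + y) (x' + y') < r"
        using S x y x' y' by (simp add: hdist_eq algebra_simps)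
      with S show ?thesis by blast
    qed
    then show "x + y \<in> htop S ip closure_of U"
      using x y subspace_add[OF subspace_S] by (auto simp: metric.metric_closure_of)
    fix c
    have "\<exists>z\<in>U. z \<in> S \<and> hdist S ip (scale c x) z < r" if "r > 0" for r
    proof -
      \<comment> \<open>The summand 1 keeps the quotient meaningful when
        \<open>c = 0\<close>.\<close>
      have "r / (norm c + 1) > 0" using that by (simp add: add_nonneg_pos)
      then obtain x' where x': "x' \<in> U" "x' \<in> S" "hdist S ip x x' < r / (norm c + 1)"
        using x(2) by blast
      have S: "scale c x \<in> S" "scale c x' \<in> S" "scale c x' \<in> U"
        using x x' U subspace_S subspace_scale by blast+
      have "hdist S ip (scale c x) (scale c x') = norm c * hdist S ip x x'"
        using S x x' hnorm_scale[of "x - x'" c]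
        by (simp add: hdist_eq diff_in_S scale_right_diff_distrib)
      also have "\<dots> \<le> (norm c + 1) * hdist S ip x x'"
        by (simp add: mult_right_mono)
      also have "\<dots> < r"
        using x'(3) by (simp add: pos_less_divide_eq add_nonneg_pos mult.commute)
      finally show ?thesis using S by blast
    qed
    then show "scale c x \<in> htop S ip closure_of U"
      using x subspace_scale[OF subspace_S] by (auto simp: metric.metric_closure_of)
  qed
qed simp

lemma closed_subspace_closed_span: "closed_subspace scale S ip (closed_span scale S ip X)"
  unfolding closed_span_def by (intro closed_subspace_closure_of subspace_span)

lemma closed_span_superset: "X \<subseteq> S \<Longrightarrow> X \<subseteq> closed_span scale S ip X"
  unfolding closed_span_def
  by (metis closure_of_subset metric.topspace_mtopology span_minimal span_superset subset_trans
      subspace_S)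

section \<open>Coordinates with respect to an orthonormal basis\<close>

lemma orthonormal_projection:
  assumes F: "finite F" "\<And>i. i \<in> F \<Longrightarrow> b i \<in> S"
    and on: "\<And>i j. i \<in> F \<Longrightarrow> j \<in> F \<Longrightarrow> ip (b i) (b j) = (if i = j then 1 else 0)"
    and v: "v \<in> S"
  obtains p where "p \<in> span (b ` F)" "\<And>w. w \<in> span (b ` F) \<Longrightarrow> ip (v - p) w = 0"
    "(hnorm ip p)\<^sup>2 = (\<Sum>i\<in>F. (norm (ip v (b i)))\<^sup>2)"
proof
  \<comment> \<open>The partial Fourier sum. Finite families are enough: a vector of a span involves
    only finitely many basis vectors, so no infinite series has to be formed.\<close>
  let ?p = "\<Sum>i\<in>F. scale (ip v (b i)) (b i)"
  have sp: "span (b ` F) \<subseteq> S" using F by (intro span_minimal subspace_S) auto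
  have bS: "scale c (b i) \<in> S" if "i \<in> F" for c i
    using F(2)[OF that] subspace_S subspace_scale by blast
  show psp: "?p \<in> span (b ` F)"
    by (intro span_sum span_scale span_base) auto
  with sp have pS: "?p \<in> S" by blast
  have pb: "ip (v - ?p) (b j) = 0" if "j \<in> F" for j
  proof -
    have "ip (b j) (scale (ip v (b i)) (b i)) = (if i = j then scnj (ip v (b i)) else 0)"
      if "i \<in> F" for i
      using F(2) on[of j i] \<open>j \<in> F\<close> that by (simp add: ip_scale_right)
    then have "ip (b j) ?p = (\<Sum>i\<in>F. if i = j then scnj (ip v (b i)) else 0)"
      using F bS that by (simp add: ip_sum_right)
    then have "ip (b j) ?p = scnj (ip v (b j))" using F that by simp
    then have "ip ?p (b j) = ip v (b j)" using ip_scnj[of "b j" ?p] pS F that by simp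
    then show ?thesis using ip_diff[OF v pS F(2)[OF that]] by simp
  qed
  show orth: "ip (v - ?p) w = 0" if "w \<in> span (b ` F)" for w
  proof -
    have vp: "v - ?p \<in> S" by (rule diff_in_S[OF v pS])
    have "subspace {w \<in> S. ip (v - ?p) w = 0}"
      using subspace_S vp unfolding subspace_def by (auto simp: ip_add_right ip_scale_right)
    moreover have "b ` F \<subseteq> {w \<in> S. ip (v - ?p) w = 0}" using F pb by auto
    ultimately have "span (b ` F) \<subseteq> {w \<in> S. ip (v - ?p) w = 0}" by (metis span_minimal)
    with that show ?thesis by blast
  qed
  have "ip ?p ?p = ip v ?p" using orth[OF psp] ip_diff[OF v pS pS] by simp
  also have "\<dots> = (\<Sum>i\<in>F. of_real ((norm (ip v (b i)))\<^sup>2))"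
    using F bS v
    by (subst ip_sum_right)
      (auto simp: ip_scale_right mult_scnj[symmetric] mult.commute simp del: of_real_power intro!: sum.cong)
  finally have "(of_real ((hnorm ip ?p)\<^sup>2) :: 'k) = of_real (\<Sum>i\<in>F. (norm (ip v (b i)))\<^sup>2)"
    using hnorm_sq[OF pS] by simp
  then show "(hnorm ip ?p)\<^sup>2 = (\<Sum>i\<in>F. (norm (ip v (b i)))\<^sup>2)"
    by (simp only: of_real_eq_iff)
qed

text \<open>Pythagoras for the orthogonal decomposition of \<open>v\<close> into
  \<open>v - p\<close> and its projection \<open>p\<close>.\<close>

lemma Bessel:
  assumes b: "orthonormal_basis scale S ip I b" and F: "finite F" "F \<subseteq> I" and v: "v \<in> S"
  shows "(\<Sum>i\<in>F. (norm (ip v (b i)))\<^sup>2) \<le> (hnorm ip v)\<^sup>2"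
proof -
  have on: "\<And>i. i \<in> F \<Longrightarrow> b i \<in> S"
    "\<And>i j. i \<in> F \<Longrightarrow> j \<in> F \<Longrightarrow> ip (b i) (b j) = (if i = j then 1 else 0)"
    using b F unfolding orthonormal_basis_def by blast+
  obtain p where p: "p \<in> span (b ` F)" "\<And>w. w \<in> span (b ` F) \<Longrightarrow> ip (v - p) w = 0"
    "(hnorm ip p)\<^sup>2 = (\<Sum>i\<in>F. (norm (ip v (b i)))\<^sup>2)"
    using orthonormal_projection[OF F(1) on v] by blast
  have "p \<in> S" using p(1) span_minimal[of "b ` F" S] subspace_S on(1) by blast
  then have "(hnorm ip v)\<^sup>2 = (hnorm ip (v - p))\<^sup>2 + (hnorm ip p)\<^sup>2"
    using pythagoras[of "v - p" p] p v diff_in_S by simp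
  with p(3) show ?thesis by simp
qed

text \<open>The other half of Parseval's identity. Totality of the basis gives a finite combination
  \<open>w\<close> near \<open>v\<close>; the projection \<open>p\<close> onto the basis vectors in
  \<open>w\<close> is at least as near, so the norm of \<open>v\<close> exceeds that of
  \<open>p\<close> by little.\<close>

lemma hnorm_le_if_coordinates:
  assumes b: "orthonormal_basis scale S ip I b" and v: "v \<in> S"
    and M: "\<And>F. finite F \<Longrightarrow> F \<subseteq> I \<Longrightarrow> (\<Sum>i\<in>F. (norm (ip v (b i)))\<^sup>2) \<le> M"
  shows "(hnorm ip v)\<^sup>2 \<le> M"
proof (rule field_le_epsilon)
  fix r :: real assume r: "r > 0"
  have "v \<in> closed_span scale S ip (b ` I)" using b v by (simp add: orthonormal_basis_def)
  then obtain w where w: "w \<in> span (b ` I)" "w \<in> S" "hdist S ip v w < sqrt r"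
    using r unfolding in_closed_span by (metis real_sqrt_gt_zero)
  obtain t c where t: "finite t" "t \<subseteq> b ` I" "w = (\<Sum>a\<in>t. scale (c a) a)"
    using w(1) unfolding span_explicit by blast
  obtain F where F: "F \<subseteq> I" "finite F" "t = b ` F"
    using finite_subset_image[OF t(1,2)] by blast
  have wF: "w \<in> span (b ` F)"
    unfolding t(3) F(3) by (intro span_sum span_scale span_base)
  have on: "\<And>i. i \<in> F \<Longrightarrow> b i \<in> S"
    "\<And>i j. i \<in> F \<Longrightarrow> j \<in> F \<Longrightarrow> ip (b i) (b j) = (if i = j then 1 else 0)"
    using b F unfolding orthonormal_basis_def by blast+
  obtain p where p: "p \<in> span (b ` F)" "\<And>w. w \<in> span (b ` F) \<Longrightarrow> ip (v - p) w = 0"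
    "(hnorm ip p)\<^sup>2 = (\<Sum>i\<in>F. (norm (ip v (b i)))\<^sup>2)"
    using orthonormal_projection[OF F(2) on v] by blast
  have pS: "p \<in> S" using p(1) span_minimal[of "b ` F" S] subspace_S on(1) by blast
  \<comment> \<open>Best approximation: \<open>p - w\<close> lies in the span to which
    \<open>v - p\<close> is orthogonal.\<close>
  have "(hnorm ip (v - w))\<^sup>2 = (hnorm ip (v - p))\<^sup>2 + (hnorm ip (p - w))\<^sup>2"
    using pythagoras[of "v - p" "p - w"] p(2)[OF span_diff[OF p(1) wF]] v pS w(2) diff_in_S
    by simp
  moreover have "(hnorm ip v)\<^sup>2 = (hnorm ip (v - p))\<^sup>2 + (hnorm ip p)\<^sup>2"
    using pythagoras[of "v - p" p] p v pS diff_in_S by simp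
  moreover have "(hnorm ip (v - w))\<^sup>2 \<le> (sqrt r)\<^sup>2"
    using w v by (intro power_mono) (auto simp: hdist_eq)
  ultimately have "(hnorm ip v)\<^sup>2 \<le> (\<Sum>i\<in>F. (norm (ip v (b i)))\<^sup>2) + r"
    using real_sqrt_pow2[of r] r p(3) zero_le_power2[of "hnorm ip (p - w)"] by linarith
  then show "(hnorm ip v)\<^sup>2 \<le> M + r" using M[OF F(2,1)] by simp
qed

lemma eq_if_coordinates:
  assumes b: "orthonormal_basis scale S ip I b" and v: "v \<in> S" and w: "w \<in> S"
    and eq: "\<And>i. i \<in> I \<Longrightarrow> ip v (b i) = ip w (b i)"
  shows "v = w"
proof -
  have bS: "b i \<in> S" if "i \<in> I" for i using b that by (auto simp: orthonormal_basis_def)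
  have "ip (v - w) (b i) = 0" if "i \<in> I" for i
    using ip_diff[OF v w bS[OF that]] eq[OF that] by simp
  then have "(hnorm ip (v - w))\<^sup>2 \<le> 0"
    using v w by (intro hnorm_le_if_coordinates[OF b] diff_in_S) (auto intro!: sum_nonpos)
  then show ?thesis using hnorm_eq_0_iff[OF diff_in_S[OF v w]] by simp
qed

text \<open>By Cauchy-Schwarz. It lets coordinates pass to the limit.\<close>

lemma tendsto_ip:
  assumes s: "\<And>n. s n \<in> S" and lim: "limitin metric.mtopology s l sequentially" and y: "y \<in> S"
  shows "(\<lambda>n. ip (s n) y) \<longlonglongrightarrow> ip l y"
proof -
  have l: "l \<in> S" and d: "(\<lambda>n. hdist S ip (s n) l) \<longlonglongrightarrow> 0"
    using lim by (auto simp: metric.limitin_metric_dist_null)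
  have "norm (ip (s n) y - ip l y) \<le> hdist S ip (s n) l * hnorm ip y" for n
    using Cauchy_Schwarz[OF diff_in_S[OF s l] y] ip_diff[OF s l y] s l by (simp add: hdist_eq)
  then have "(\<lambda>n. ip (s n) y - ip l y) \<longlonglongrightarrow> 0"
    by (intro Lim_null_comparison[OF _ tendsto_mult_left_zero[OF d]] always_eventually allI)
  then show ?thesis by (rule LIM_zero_cancel)
qed

lemma closed_span_mono: "X \<subseteq> Y \<Longrightarrow> closed_span scale S ip X \<subseteq> closed_span scale S ip Y"
  unfolding closed_span_def by (intro closure_of_mono span_mono)

end


section \<open>Square summable families and the isometric embedding\<close>

lemma ell2_sum_le_hnorm:
  assumes f: "f \<in> ell2 A" and F: "finite F" "F \<subseteq> A"
  shows "(\<Sum>i\<in>F. (norm (f i))\<^sup>2) \<le> (hnorm (ell2_ip A) f)\<^sup>2"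
proof -
  have "(\<lambda>i. (norm (f i))\<^sup>2) summable_on A" using f by (simp add: ell2_def)
  then have "(\<Sum>i\<in>F. (norm (f i))\<^sup>2) \<le> (\<Sum>\<^sub>\<infinity>i\<in>A. (norm (f i))\<^sup>2)"
    using F by (intro finite_sum_le_infsum) auto
  then show ?thesis by (simp add: ell2_hnorm f infsum_nonneg)
qed

lemma ell2I:
  fixes f :: "'i \<Rightarrow> 'k::rc_field"
  assumes "\<And>i. i \<notin> A \<Longrightarrow> f i = 0" and "0 \<le> M"
    and F: "\<And>F. finite F \<Longrightarrow> F \<subseteq> A \<Longrightarrow> (\<Sum>i\<in>F. (norm (f i))\<^sup>2) \<le> M\<^sup>2"
  shows "f \<in> ell2 A" "hnorm (ell2_ip A) f \<le> M"
proof -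
  have sm: "(\<lambda>i. (norm (f i))\<^sup>2) summable_on A"
    using F by (intro nonneg_bdd_above_summable_on) (auto intro!: bdd_aboveI2)
  then show f: "f \<in> ell2 A" using assms by (auto simp: ell2_def)
  have "(\<Sum>\<^sub>\<infinity>i\<in>A. (norm (f i))\<^sup>2) \<le> M\<^sup>2"
    using sm F by (rule infsum_le_finite_sums)
  then show "hnorm (ell2_ip A) f \<le> M"
    unfolding ell2_hnorm[OF f] using \<open>0 \<le> M\<close> by (intro real_le_lsqrt) auto
qed

lemma norm_diff_le_ell2_hdist:
  assumes "f \<in> ell2 A" "g \<in> ell2 A" "i \<in> A"
  shows "norm (f i - g i) \<le> hdist (ell2 A) (ell2_ip A) f g"
  by (rule power2_le_imp_le)
    (use ell2_sum_le_hdist[OF assms(1,2), of "{i}"] assms(3) in \<open>auto simp: hdist_def hnorm_def\<close>)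

text \<open>An index with zero tail is determined by its restriction, so each finite sum for the
  embedded family is a finite sum for \<open>u\<close>.\<close>

lemma tensor_embed_ell2:
  fixes u :: "(nat \<Rightarrow> nat) \<Rightarrow> 'k::rc_field"
  assumes u: "u \<in> ell2 (fin_idx I m)"
  shows "tensor_embed I m u \<in> ell2 (inf_idx I)"
proof (rule ell2I(1))
  show "tensor_embed I m u \<alpha> = 0" if "\<alpha> \<notin> inf_idx I" for \<alpha>
    using that by (simp add: tensor_embed_def)
  show "0 \<le> hnorm (ell2_ip (fin_idx I m)) u" by (simp add: hnorm_def)
  fix F assume F: "finite F" "F \<subseteq> inf_idx I"
  let ?T = "{\<alpha> \<in> inf_idx I. \<forall>n\<ge>m. \<alpha> n = 0}" and ?r = "\<lambda>\<alpha>. restrict \<alpha> {..<m}"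
  have inj: "inj_on ?r ?T"
  proof (rule inj_onI, rule ext)
    fix \<alpha> \<beta> k assume *: "\<alpha> \<in> ?T" "\<beta> \<in> ?T" "?r \<alpha> = ?r \<beta>"
    show "\<alpha> k = \<beta> k"
      using *(1,2) fun_cong[OF *(3), of k] by (cases "k < m") auto
  qed
  have "(\<Sum>\<alpha>\<in>F. (norm (tensor_embed I m u \<alpha>))\<^sup>2) = (\<Sum>\<alpha>\<in>F \<inter> ?T. (norm (u (?r \<alpha>)))\<^sup>2)"
    using F by (intro sum.mono_neutral_cong_right) (auto simp: tensor_embed_def)
  also have "\<dots> = (\<Sum>\<alpha>\<in>?r ` (F \<inter> ?T). (norm (u \<alpha>))\<^sup>2)"
    using inj_on_subset[OF inj, of "F \<inter> ?T"] by (simp add: sum.reindex)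
  also have "\<dots> \<le> (hnorm (ell2_ip (fin_idx I m)) u)\<^sup>2"
    using F by (intro ell2_sum_le_hnorm u) (auto simp: inf_idx_def fin_idx_def split: if_splits)
  finally show "(\<Sum>\<alpha>\<in>F. (norm (tensor_embed I m u \<alpha>))\<^sup>2) \<le> (hnorm (ell2_ip (fin_idx I m)) u)\<^sup>2" .
qed

lemma tensor_embed_0: "tensor_embed I m 0 = 0"
  by (auto simp: tensor_embed_def fun_eq_iff)

lemma tensor_embed_add: "tensor_embed I m (u + v) = tensor_embed I m u + tensor_embed I m v"
  by (auto simp: tensor_embed_def fun_eq_iff)

lemma tensor_embed_diff: "tensor_embed I m (u - v) = tensor_embed I m u - tensor_embed I m v"
  by (auto simp: tensor_embed_def fun_eq_iff)

lemma tensor_embed_fscale: "tensor_embed I m (fscale c u) = fscale c (tensor_embed I m u)"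
  by (auto simp: tensor_embed_def fscale_def fun_eq_iff)

lemma hdist_tensor_embed:
  assumes "\<And>n. 0 \<in> I n" "u \<in> ell2 (fin_idx I m)" "v \<in> ell2 (fin_idx I m)"
  shows "hdist (inf_tensor I) (inf_tensor_ip I) (tensor_embed I m u) (tensor_embed I m v) =
    hdist (ell2 (fin_idx I m)) (ell2_ip (fin_idx I m)) u v"
  using assms
  by (simp add: hdist_def tensor_embed_ell2 hnorm_def tensor_embed_isometry
      flip: tensor_embed_diff)

text \<open>The preimage of a closed subspace under a linear isometry is a closed subspace; if it
  contains the generators, it contains their closed span.\<close>

lemma tensor_embed_closed_span:
  fixes X :: "((nat \<Rightarrow> nat) \<Rightarrow> 'k::rc_field) set"
  assumes I0: "\<And>n. 0 \<in> I n" and X: "X \<subseteq> ell2 (fin_idx I m)"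
    and C: "closed_subspace fscale (inf_tensor I) (inf_tensor_ip I) C"
    and XC: "tensor_embed I m ` X \<subseteq> C"
  shows "tensor_embed I m ` closed_span fscale (ell2 (fin_idx I m)) (ell2_ip (fin_idx I m)) X \<subseteq> C"
proof -
  interpret fin: hilbert_space fscale "ell2 (fin_idx I m) :: ((nat \<Rightarrow> nat) \<Rightarrow> 'k) set" "ell2_ip (fin_idx I m)"
    by (rule hilbert_space_ell2)
  interpret inf: hilbert_space fscale "inf_tensor I :: ((nat \<Rightarrow> nat) \<Rightarrow> 'k) set" "inf_tensor_ip I"
    by (rule hilbert_space_ell2)
  let ?P = "{u \<in> ell2 (fin_idx I m). tensor_embed I m u \<in> C}"
  have sub: "fin.subspace C" using C by (simp add: closed_subspace_def)
  have "closed_subspace fscale (ell2 (fin_idx I m)) (ell2_ip (fin_idx I m)) ?P"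
    unfolding fin.closed_subspace_iff
  proof (intro conjI ballI impI)
    show "fin.subspace ?P"
      using sub fin.subspace_S unfolding fin.subspace_def
      by (simp add: tensor_embed_0 tensor_embed_add tensor_embed_fscale)
    fix u :: "(nat \<Rightarrow> nat) \<Rightarrow> 'k" assume u: "u \<in> ell2 (fin_idx I m)"
      and "\<forall>r>0. \<exists>v\<in>?P. hdist (ell2 (fin_idx I m)) (ell2_ip (fin_idx I m)) u v < r"
    then have "\<forall>r>0. \<exists>y\<in>C. hdist (inf_tensor I) (inf_tensor_ip I) (tensor_embed I m u) y < r"
      using hdist_tensor_embed[OF I0 u] by (smt (verit, best) mem_Collect_eq)
    then have "tensor_embed I m u \<in> C"
      using C tensor_embed_ell2[OF u] unfolding inf.closed_subspace_iff by blast
    with u show "u \<in> ?P" by blast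
  qed blast
  then have "closed_span fscale (ell2 (fin_idx I m)) (ell2_ip (fin_idx I m)) X \<subseteq> ?P"
    using X XC by (intro fin.closed_span_minimal) auto
  then show ?thesis by blast
qed

lemma tensor_embed_unit:
  assumes \<alpha>: "\<alpha> \<in> inf_idx I" "\<And>n. n \<ge> m \<Longrightarrow> \<alpha> n = 0"
  shows "tensor_embed I m (\<lambda>\<beta>. if \<beta> = restrict \<alpha> {..<m} then 1 else 0) =
    (\<lambda>\<beta>. if \<beta> = \<alpha> then 1 else 0)"
proof
  fix \<beta> :: "nat \<Rightarrow> nat"
  have "\<beta> = \<alpha>" if "restrict \<beta> {..<m} = restrict \<alpha> {..<m}" "\<forall>n\<ge>m. \<beta> n = 0"
  proof
    fix k show "\<beta> k = \<alpha> k"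
      using that(2) \<alpha>(2)[of k] fun_cong[OF that(1), of k] by (cases "k < m") auto
  qed
  then show "tensor_embed I m (\<lambda>\<beta>. if \<beta> = restrict \<alpha> {..<m} then 1 else 0) \<beta> =
      (if \<beta> = \<alpha> then 1 else 0)"
    using \<alpha> by (auto simp: tensor_embed_def)
qed

text \<open>Two vectors of the union lie in a common member of the chain, so the union is already a
  subspace. Hence density can be tested on basis vectors.\<close>

lemma closed_subspace_Union_chain:
  fixes W :: "int \<Rightarrow> ('i \<Rightarrow> 'k::rc_field) set"
  assumes W: "\<And>j. module.subspace fscale (W j)" and mono: "mono W"
  shows "closed_subspace fscale (ell2 A) (ell2_ip A) (htop (ell2 A) (ell2_ip A) closure_of (\<Union>j. W j))"
proof -
  interpret hilbert_space fscale "ell2 A :: ('i \<Rightarrow> 'k) set" "ell2_ip A"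
    by (rule hilbert_space_ell2)
  have "subspace (\<Union>j. W j)"
  proof (rule subspaceI)
    show "0 \<in> (\<Union>j. W j)" using subspace_0[OF W] by blast
    show "fscale c x \<in> (\<Union>j. W j)" if "x \<in> (\<Union>j. W j)" for c x
      using that subspace_scale[OF W] by blast
    fix x y assume "x \<in> (\<Union>j. W j)" "y \<in> (\<Union>j. W j)"
    then obtain i j where "x \<in> W i" "y \<in> W j" by blast
    then have "x \<in> W (max i j)" "y \<in> W (max i j)"
      using monoD[OF mono, of i "max i j"] monoD[OF mono, of j "max i j"] by auto
    then show "x + y \<in> (\<Union>j. W j)" using subspace_add[OF W] by blast
  qed
  then show ?thesis by (rule closed_subspace_closure_of)
qed

section \<open>Elementary tensors and the subspaces they generate\<close>

locale tensor_factors =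
  fixes scale :: "'k::rc_field \<Rightarrow> 'a::ab_group_add \<Rightarrow> 'a"
    and H :: "nat \<Rightarrow> 'a set"
    and ip :: "nat \<Rightarrow> 'a \<Rightarrow> 'a \<Rightarrow> 'k"
    and I :: "nat \<Rightarrow> nat set"
    and b :: "nat \<Rightarrow> nat \<Rightarrow> 'a"
  assumes hilbert: "\<And>n. hilbert_space scale (H n) (ip n)"
    and basis: "\<And>n. orthonormal_basis scale (H n) (ip n) (I n) (b n)"
    and I0: "\<And>n. 0 \<in> I n"
begin

sublocale factor: hilbert_space scale "H n" "ip n" for n
  by (rule hilbert)

sublocale whole: hilbert_space fscale "inf_tensor I :: ((nat \<Rightarrow> nat) \<Rightarrow> 'k) set" "inf_tensor_ip I"
  by (rule hilbert_space_ell2)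

lemma basis_in_H: "i \<in> I n \<Longrightarrow> b n i \<in> H n"
  using basis[of n] by (auto simp: orthonormal_basis_def)

lemma
  assumes f: "\<And>k. k < m \<Longrightarrow> f k \<in> H k"
  shows elem_tensor_ell2: "elem_tensor ip I b m f \<in> ell2 (fin_idx I m)"
    and hnorm_elem_tensor_le:
      "hnorm (ell2_ip (fin_idx I m)) (elem_tensor ip I b m f) \<le> (\<Prod>k<m. hnorm (ip k) (f k))"
proof -
  have bound: "(\<Sum>\<alpha>\<in>F. (norm (elem_tensor ip I b m f \<alpha>))\<^sup>2) \<le> (\<Prod>k<m. hnorm (ip k) (f k))\<^sup>2"
    if F: "finite F" "F \<subseteq> fin_idx I m" for F
  proof -
    let ?G = "\<lambda>k. (\<lambda>\<alpha>. \<alpha> k) ` F" and ?N = "\<lambda>k i. (norm (ip k (f k) (b k i)))\<^sup>2"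
    have G: "?G k \<subseteq> I k" if "k < m" for k
      using F(2) that by (auto simp: fin_idx_def)
    have "(\<Sum>\<alpha>\<in>F. (norm (elem_tensor ip I b m f \<alpha>))\<^sup>2) = (\<Sum>\<alpha>\<in>F. \<Prod>k<m. ?N k (\<alpha> k))"
      using F(2) by (intro sum.cong) (auto simp: elem_tensor_def prod_power_distrib simp flip: prod_norm)
    \<comment> \<open>The finite index set is enlarged to the box spanned by its coordinate
      projections, where the sum of products factors into a product of sums; Bessel then bounds each
      of these.\<close>
    also have "\<dots> \<le> (\<Sum>\<alpha>\<in>PiE {..<m} ?G. \<Prod>k<m. ?N k (\<alpha> k))"
      using F by (intro sum_mono2 finite_PiE) (auto simp: fin_idx_def PiE_def intro!: prod_nonneg)
    also have "\<dots> = (\<Prod>k<m. \<Sum>i\<in>?G k. ?N k i)"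
      using F(1) by (intro prod_sum_PiE[symmetric]) auto
    also have "\<dots> \<le> (\<Prod>k<m. (hnorm (ip k) (f k))\<^sup>2)"
      using F(1) G f by (intro prod_mono conjI sum_nonneg factor.Bessel[OF basis]) auto
    finally show ?thesis by (simp add: prod_power_distrib)
  qed
  have "elem_tensor ip I b m f \<alpha> = 0" if "\<alpha> \<notin> fin_idx I m" for \<alpha>
    using that by (simp add: elem_tensor_def)
  moreover have "0 \<le> (\<Prod>k<m. hnorm (ip k) (f k))" by (intro prod_nonneg) simp
  ultimately show "elem_tensor ip I b m f \<in> ell2 (fin_idx I m)"
    "hnorm (ell2_ip (fin_idx I m)) (elem_tensor ip I b m f) \<le> (\<Prod>k<m. hnorm (ip k) (f k))"
    using ell2I[OF _ _ bound] by blast+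
qed

text \<open>Additivity in slot \<open>l\<close>: exchanging one factor costs an elementary tensor
  with the error vector in that slot.\<close>

lemma elem_tensor_diff:
  assumes l: "l < m" and f: "f l \<in> H l" and g: "g \<in> H l"
  shows "elem_tensor ip I b m f - elem_tensor ip I b m (f(l := g)) =
    elem_tensor ip I b m (f(l := f l - g))"
proof
  fix \<alpha>
  show "(elem_tensor ip I b m f - elem_tensor ip I b m (f(l := g))) \<alpha> =
      elem_tensor ip I b m (f(l := f l - g)) \<alpha>"
  proof (cases "\<alpha> \<in> fin_idx I m")
    case True
    then have bl: "b l (\<alpha> l) \<in> H l" using l basis_in_H by (auto simp: fin_idx_def)
    have "(\<Prod>k<m. ip k (h k) (b k (\<alpha> k))) =
        ip l (h l) (b l (\<alpha> l)) * (\<Prod>k\<in>{..<m} - {l}. ip k (h k) (b k (\<alpha> k)))" for h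
      using l by (intro prod.remove) auto
    then show ?thesis
      using True factor.ip_diff[OF f g bl] by (simp add: elem_tensor_def left_diff_distrib)
  qed (simp add: elem_tensor_def)
qed

lemma closed_subspace_V_inf:
  "closed_subspace fscale (inf_tensor I) (inf_tensor_ip I) (V_inf ip I b V j)"
  unfolding V_inf_def by (rule whole.closed_subspace_closed_span)

lemma V_inf_subset_mono:
  assumes "\<And>k. V k i \<subseteq> V k j"
  shows "V_inf ip I b V i \<subseteq> V_inf ip I b V j"
proof -
  interpret fin: hilbert_space fscale "ell2 (fin_idx I m) :: ((nat \<Rightarrow> nat) \<Rightarrow> 'k) set"
    "ell2_ip (fin_idx I m)" for m
    by (rule hilbert_space_ell2)
  have "V_fin ip I b V m i \<subseteq> V_fin ip I b V m j" for m
    unfolding V_fin_def tensor_subspace_def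
    by (intro image_mono fin.closed_span_mono) (use assms in blast)
  then show ?thesis
    unfolding V_inf_def by (intro whole.closed_span_mono) blast
qed

text \<open>Removes both the completion and the embedding: inclusion in a closed subspace is decided
  on elementary tensors.\<close>

lemma V_fin_subset_iff:
  assumes C: "closed_subspace fscale (inf_tensor I) (inf_tensor_ip I) C"
    and V: "\<And>k. V k j \<subseteq> H k"
  shows "V_fin ip I b V m j \<subseteq> C \<longleftrightarrow>
    (\<forall>f. (\<forall>k<m. f k \<in> V k j) \<longrightarrow> tensor_embed I m (elem_tensor ip I b m f) \<in> C)"
proof -
  interpret fin: hilbert_space fscale "ell2 (fin_idx I m) :: ((nat \<Rightarrow> nat) \<Rightarrow> 'k) set"
    "ell2_ip (fin_idx I m)"
    by (rule hilbert_space_ell2)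
  let ?X = "{elem_tensor ip I b m f | f. \<forall>k<m. f k \<in> V k j}"
  have X: "?X \<subseteq> ell2 (fin_idx I m)" using V elem_tensor_ell2 by blast
  show ?thesis
    unfolding V_fin_def tensor_subspace_def
    using tensor_embed_closed_span[OF I0 X C] fin.closed_span_superset[OF X] by blast
qed

lemma elem_tensor_in_V_inf:
  assumes V: "\<And>k. V k j \<subseteq> H k" and m: "m \<ge> 1" and f: "\<And>k. k < m \<Longrightarrow> f k \<in> V k j"
  shows "tensor_embed I m (elem_tensor ip I b m f) \<in> V_inf ip I b V j"
proof -
  \<comment> \<open>With the whole space as test subspace, the criterion yields that each
    \<open>V_fin\<close> lies in the carrier, which is needed for a set to be contained in its
    closed span.\<close>
  have H: "closed_subspace fscale (inf_tensor I) (inf_tensor_ip I) (inf_tensor I :: ((nat \<Rightarrow> nat) \<Rightarrow> 'k) set)"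
    using whole.subspace_S by (simp add: whole.closed_subspace_iff)
  have "V_fin ip I b V n j \<subseteq> inf_tensor I" for n
    using V by (auto simp: V_fin_subset_iff[OF H, of V j, OF V] intro!: tensor_embed_ell2 elem_tensor_ell2)
  then have "V_fin ip I b V m j \<subseteq> V_inf ip I b V j"
    unfolding V_inf_def using whole.closed_span_superset[of "\<Union>m\<in>{1..}. V_fin ip I b V m j"] m by auto
  then show ?thesis using V f by (simp add: V_fin_subset_iff[OF closed_subspace_V_inf])
qed

text \<open>Exchanges one factor at a time, keeping the others fixed, so that each limit involves a
  single slot.\<close>

lemma elem_tensor_in_closed:
  assumes C: "closed_subspace fscale (inf_tensor I) (inf_tensor_ip I) C"
    and U: "\<And>k. htop (H k) (ip k) closure_of (U k) = H k" "\<And>k. U k \<subseteq> H k"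
    and UC: "\<And>f. (\<And>k. k < m \<Longrightarrow> f k \<in> U k) \<Longrightarrow> tensor_embed I m (elem_tensor ip I b m f) \<in> C"
    and f: "\<And>k. k < m \<Longrightarrow> f k \<in> H k"
  shows "tensor_embed I m (elem_tensor ip I b m f) \<in> C"
proof -
  \<comment> \<open>Invariant: the first \<open>l\<close> factors are arbitrary, those from
    \<open>l\<close> on already lie in \<open>U k\<close>. The step replaces factor \<open>l\<close>
    by some \<open>g\<close> from \<open>U l\<close>, which returns to the induction
    hypothesis.\<close>
  have "tensor_embed I m (elem_tensor ip I b m f) \<in> C"
    if "l \<le> m" "\<And>k. k < m \<Longrightarrow> f k \<in> H k" "\<And>k. l \<le> k \<Longrightarrow> k < m \<Longrightarrow> f k \<in> U k" for l f
    using that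
  proof (induction l arbitrary: f)
    case 0
    show ?case by (rule UC) (use 0 in simp)
  next
    case (Suc l)
    note f = Suc.prems(2)
    have l: "l < m" using Suc.prems by simp
    let ?e = "elem_tensor ip I b m"
    have "\<exists>y\<in>C. hdist (inf_tensor I) (inf_tensor_ip I) (tensor_embed I m (?e f)) y < r"
      if r: "r > 0" for r
    proof -
      \<comment> \<open>The product of the remaining norms is the factor by which the error in slot
        \<open>l\<close> is magnified; dividing by \<open>P + 1\<close> also covers
        \<open>P = 0\<close>.\<close>
      define P where "P = (\<Prod>k\<in>{..<m} - {l}. hnorm (ip k) (f k))"
      have P: "P \<ge> 0" unfolding P_def by (intro prod_nonneg) simp
      have "f l \<in> htop (H l) (ip l) closure_of (U l)" using f[OF l] U(1)[of l] by simp
      then have "\<forall>r>0. \<exists>g\<in>U l. hdist (H l) (ip l) (f l) g < r"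
        by (auto simp: factor.metric.metric_closure_of)
      moreover have "r / (P + 1) > 0" using r P by simp
      ultimately obtain g where g: "g \<in> U l" "hdist (H l) (ip l) (f l) g < r / (P + 1)"
        by blast
      have gH: "g \<in> H l" using g U by blast
      have fg: "(f(l := g)) k \<in> H k" if "k < m" for k using that f gH by simp
      have fd: "(f(l := f l - g)) k \<in> H k" if "k < m" for k
        using that f gH factor.diff_in_S by simp
      have "tensor_embed I m (?e (f(l := g))) \<in> C"
      proof (rule Suc.IH)
        show "l \<le> m" using l by simp
        show "(f(l := g)) k \<in> H k" if "k < m" for k using that by (rule fg)
        show "(f(l := g)) k \<in> U k" if "l \<le> k" "k < m" for k
          using that g(1) Suc.prems(3)[of k] by (cases "k = l") auto
      qed
      moreover have "hdist (inf_tensor I) (inf_tensor_ip I) (tensor_embed I m (?e f))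
          (tensor_embed I m (?e (f(l := g)))) < r"
      proof -
        have "hdist (inf_tensor I) (inf_tensor_ip I) (tensor_embed I m (?e f))
            (tensor_embed I m (?e (f(l := g)))) =
            hdist (ell2 (fin_idx I m)) (ell2_ip (fin_idx I m)) (?e f) (?e (f(l := g)))"
          by (rule hdist_tensor_embed[OF I0 elem_tensor_ell2[OF f] elem_tensor_ell2[OF fg]])
        also have "\<dots> = hnorm (ell2_ip (fin_idx I m)) (?e f - ?e (f(l := g)))"
          by (intro hilbert_space.hdist_eq[OF hilbert_space_ell2] elem_tensor_ell2 f fg)
        also have "\<dots> = hnorm (ell2_ip (fin_idx I m)) (?e (f(l := f l - g)))"
          by (simp only: elem_tensor_diff[where f = f, OF l f[OF l] gH])
        also have "\<dots> \<le> (\<Prod>k<m. hnorm (ip k) ((f(l := f l - g)) k))"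
          using fd by (rule hnorm_elem_tensor_le)
        also have "\<dots> = hnorm (ip l) (f l - g) * P"
        proof -
          have "(\<Prod>k\<in>{..<m} - {l}. hnorm (ip k) ((f(l := f l - g)) k)) = P"
            unfolding P_def by (rule prod.cong) auto
          then show ?thesis
            using l prod.remove[of "{..<m}" l "\<lambda>k. hnorm (ip k) ((f(l := f l - g)) k)"] by simp
        qed
        also have "\<dots> \<le> hdist (H l) (ip l) (f l) g * (P + 1)"
          using f[OF l] gH P by (simp add: factor.hdist_eq mult_left_mono)
        also have "\<dots> < r" using g(2) P by (simp add: pos_less_divide_eq)
        finally show ?thesis .
      qed
      ultimately show ?thesis by blast
    qed
    moreover have "tensor_embed I m (?e f) \<in> inf_tensor I"
      using f by (intro tensor_embed_ell2 elem_tensor_ell2)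
    ultimately show ?case
      using whole.closed_subspaceD[OF C] by blast
  qed
  from this[of m f, OF order_refl f] show ?thesis by simp
qed

section \<open>Slices along the first factor\<close>

text \<open>For closed \<open>W\<close> this is the completed tensor product of \<open>W\<close>
  with all later factors. A slice is the partial inner product with a basis vector of the tail,
  given by its coordinates in \<open>H 0\<close>. The entry \<open>\<beta> 0\<close> is overwritten,
  so \<open>\<beta>\<close> stands for a tail.\<close>

definition slice_space :: "'a set \<Rightarrow> ((nat \<Rightarrow> nat) \<Rightarrow> 'k) set" where
  "slice_space W = {x \<in> inf_tensor I. \<forall>\<beta>\<in>inf_idx I. \<exists>v\<in>W. \<forall>i\<in>I 0. ip 0 v (b 0 i) = x (\<beta>(0 := i))}"

lemma inf_idx_upd:
  assumes "\<beta> \<in> inf_idx I" "i \<in> I 0"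
  shows "\<beta>(0 := i) \<in> inf_idx I"
proof -
  have "\<forall>\<^sub>F n in sequentially. \<beta> n = 0" using assms by (simp add: inf_idx_def)
  then have "\<forall>\<^sub>F n in sequentially. (\<beta>(0 := i)) n = 0"
    using eventually_gt_at_top[of 0] by eventually_elim simp
  then show ?thesis using assms by (simp add: inf_idx_def)
qed

text \<open>Taking a slice is a contraction. The slices of an approximating sequence are therefore
  Cauchy in \<open>H 0\<close>, and their limit, which stays in \<open>W\<close>, has the
  coordinates of the slice of \<open>x\<close>.\<close>

lemma slice_space_closure:
  assumes W: "closed_subspace scale (H 0) (ip 0) W" and x: "x \<in> inf_tensor I"
    and ap: "\<And>r. r > 0 \<Longrightarrow> \<exists>y\<in>slice_space W. hdist (inf_tensor I) (inf_tensor_ip I) x y < r"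
    and \<beta>: "\<beta> \<in> inf_idx I"
  shows "\<exists>v\<in>W. \<forall>i\<in>I 0. ip 0 v (b 0 i) = x (\<beta>(0 := i))"
proof -
  let ?d = "hdist (inf_tensor I) (inf_tensor_ip I) :: ((nat \<Rightarrow> nat) \<Rightarrow> 'k) \<Rightarrow> _"
  have "x \<in> htop (inf_tensor I) (inf_tensor_ip I) closure_of slice_space W"
    using x ap by (auto simp: whole.metric.metric_closure_of slice_space_def)
  then obtain y where y: "range y \<subseteq> slice_space W \<inter> inf_tensor I"
    and lim: "limitin whole.metric.mtopology y x sequentially"
    unfolding whole.metric.closure_of_sequentially by blast
  have yI: "y n \<in> inf_tensor I" for n using y by blast
  have "\<exists>v\<in>W. \<forall>i\<in>I 0. ip 0 v (b 0 i) = y n (\<beta>(0 := i))" for n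
    using y \<beta> unfolding slice_space_def by blast
  then obtain v where vW: "\<And>n. v n \<in> W"
    and v: "\<And>n i. i \<in> I 0 \<Longrightarrow> ip 0 (v n) (b 0 i) = y n (\<beta>(0 := i))"
    by metis
  have vH: "v n \<in> H 0" for n using vW W by (auto simp: factor.closed_subspace_iff)
  \<comment> \<open>The indices \<open>\<beta>(0 := i)\<close> are distinct for distinct
    \<open>i\<close>, so the coordinates of the slice form part of the whole family.\<close>
  have le: "hdist (H 0) (ip 0) (v n) (v k) \<le> ?d (y n) (y k)" for n k
  proof -
    have "(\<Sum>i\<in>F. (norm (ip 0 (v n - v k) (b 0 i)))\<^sup>2) \<le> (?d (y n) (y k))\<^sup>2"
      if F: "finite F" "F \<subseteq> I 0" for F
    proof -
      have inj: "inj_on (\<lambda>i. \<beta>(0 := i)) F" by (rule inj_onI) (metis fun_upd_same)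
      have "ip 0 (v n - v k) (b 0 i) = y n (\<beta>(0 := i)) - y k (\<beta>(0 := i))" if "i \<in> F" for i
        using that F(2) v vH basis_in_H by (auto simp: factor.ip_diff)
      then have "(\<Sum>i\<in>F. (norm (ip 0 (v n - v k) (b 0 i)))\<^sup>2) =
          (\<Sum>\<alpha>\<in>(\<lambda>i. \<beta>(0 := i)) ` F. (norm (y n \<alpha> - y k \<alpha>))\<^sup>2)"
        using inj by (simp add: sum.reindex)
      also have "\<dots> \<le> (?d (y n) (y k))\<^sup>2"
        using F \<beta> inf_idx_upd by (intro ell2_sum_le_hdist yI) auto
      finally show ?thesis .
    qed
    then have "(hnorm (ip 0) (v n - v k))\<^sup>2 \<le> (?d (y n) (y k))\<^sup>2"
      by (intro factor.hnorm_le_if_coordinates[OF basis] factor.diff_in_S vH)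
    then have "hnorm (ip 0) (v n - v k) \<le> ?d (y n) (y k)"
      by (rule power2_le_imp_le) simp
    then show ?thesis using vH by (simp add: factor.hdist_eq)
  qed
  have "whole.metric.MCauchy y"
    using yI lim by (intro whole.metric.convergent_imp_MCauchy) auto
  then have "factor.metric.MCauchy 0 v"
    unfolding factor.metric.MCauchy_def
  proof (intro conjI allI impI)
    show "range v \<subseteq> H 0" using vH by blast
    fix r :: real assume "r > 0"
    with \<open>whole.metric.MCauchy y\<close> obtain N where
      N: "\<And>n k. N \<le> n \<Longrightarrow> N \<le> k \<Longrightarrow> ?d (y n) (y k) < r"
      unfolding whole.metric.MCauchy_def by blast
    then show "\<exists>N. \<forall>n k. N \<le> n \<longrightarrow> N \<le> k \<longrightarrow> hdist (H 0) (ip 0) (v n) (v k) < r"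
      using le_less_trans[OF le N] by blast
  qed
  then obtain w where w: "limitin (factor.metric.mtopology 0) v w sequentially"
    using factor.complete unfolding factor.metric.mcomplete_def by blast
  have wW: "w \<in> W"
  proof -
    have "closedin (factor.metric.mtopology 0) W" using W by (simp add: closed_subspace_def)
    moreover have "range v \<subseteq> W" using vW by blast
    ultimately show ?thesis
      using w unfolding factor.metric.metric_closedin_iff_sequentially_closed by blast
  qed
  \<comment> \<open>Both sides are limits of the same scalar sequence: one by continuity of the
    inner product, one because a coordinate difference is at most the distance.\<close>
  have "ip 0 w (b 0 i) = x (\<beta>(0 := i))" if i: "i \<in> I 0" for i
  proof (rule LIMSEQ_unique)
    have "(\<lambda>n. ip 0 (v n) (b 0 i)) \<longlonglongrightarrow> ip 0 w (b 0 i)"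
      using vH w basis_in_H[OF i] by (rule factor.tendsto_ip)
    then show "(\<lambda>n. y n (\<beta>(0 := i))) \<longlonglongrightarrow> ip 0 w (b 0 i)" using v[OF i] by simp
    have "(\<lambda>n. ?d (y n) x) \<longlonglongrightarrow> 0"
      using lim by (simp add: whole.metric.limitin_metric_dist_null)
    then have "(\<lambda>n. y n (\<beta>(0 := i)) - x (\<beta>(0 := i))) \<longlonglongrightarrow> 0"
      by (rule Lim_null_comparison[rotated])
        (intro always_eventually allI norm_diff_le_ell2_hdist yI x inf_idx_upd \<beta> i)
    then show "(\<lambda>n. y n (\<beta>(0 := i))) \<longlonglongrightarrow> x (\<beta>(0 := i))" by (rule LIM_zero_cancel)
  qed
  with wW show ?thesis by blast
qed

lemma closed_subspace_slice_space:
  assumes W: "closed_subspace scale (H 0) (ip 0) W"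
  shows "closed_subspace fscale (inf_tensor I) (inf_tensor_ip I) (slice_space W)"
  unfolding whole.closed_subspace_iff
proof (intro conjI ballI impI)
  have sub: "factor.subspace W" and WH: "W \<subseteq> H 0"
    using W by (auto simp: factor.closed_subspace_iff)
  show "whole.subspace (slice_space W)"
  proof (rule whole.subspaceI)
    show "0 \<in> slice_space W"
      using factor.subspace_0[OF sub] whole.subspace_0[OF whole.subspace_S] basis_in_H
      by (auto simp: slice_space_def intro!: bexI[of _ 0])
    fix x y assume xy: "x \<in> slice_space W" "y \<in> slice_space W"
    have "\<exists>v\<in>W. \<forall>i\<in>I 0. ip 0 v (b 0 i) = (x + y) (\<beta>(0 := i))" if "\<beta> \<in> inf_idx I" for \<beta>
    proof -
      obtain v w where "v \<in> W" "\<forall>i\<in>I 0. ip 0 v (b 0 i) = x (\<beta>(0 := i))"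
        "w \<in> W" "\<forall>i\<in>I 0. ip 0 w (b 0 i) = y (\<beta>(0 := i))"
        using xy \<open>\<beta> \<in> inf_idx I\<close> unfolding slice_space_def by blast
      then show ?thesis
        using factor.subspace_add[OF sub] WH basis_in_H
        by (intro bexI[of _ "v + w"]) (auto simp: factor.ip_add subset_iff)
    qed
    then show "x + y \<in> slice_space W"
      using xy by (auto simp: slice_space_def ell2_add)
    fix c
    have "\<exists>v\<in>W. \<forall>i\<in>I 0. ip 0 v (b 0 i) = fscale c x (\<beta>(0 := i))" if "\<beta> \<in> inf_idx I" for \<beta>
    proof -
      obtain v where "v \<in> W" "\<forall>i\<in>I 0. ip 0 v (b 0 i) = x (\<beta>(0 := i))"
        using xy \<open>\<beta> \<in> inf_idx I\<close> unfolding slice_space_def by blast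
      then show ?thesis
        using factor.subspace_scale[OF sub] WH basis_in_H
        by (intro bexI[of _ "scale c v"]) (auto simp: factor.ip_scale fscale_def subset_iff)
    qed
    then show "fscale c x \<in> slice_space W"
      using xy by (auto simp: slice_space_def ell2_fscale)
  qed
  show "slice_space W \<subseteq> inf_tensor I" by (auto simp: slice_space_def)
  fix x :: "(nat \<Rightarrow> nat) \<Rightarrow> 'k" assume x: "x \<in> inf_tensor I"
    and "\<forall>r>0. \<exists>y\<in>slice_space W. hdist (inf_tensor I) (inf_tensor_ip I) x y < r"
  then have ap: "\<And>r. r > 0 \<Longrightarrow> \<exists>y\<in>slice_space W. hdist (inf_tensor I) (inf_tensor_ip I) x y < r"
    by blast
  from slice_space_closure[OF W x ap] x show "x \<in> slice_space W"
    by (simp add: slice_space_def)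
qed

text \<open>Each slice of an elementary tensor is a scalar multiple of its first factor.\<close>

lemma V_inf_subset_slice_space:
  assumes V: "\<And>k. closed_subspace scale (H k) (ip k) (V k j)"
  shows "V_inf ip I b V j \<subseteq> slice_space (V 0 j)"
proof -
  have VH: "V k j \<subseteq> H k" for k using V by (simp add: factor.closed_subspace_iff)
  have C: "closed_subspace fscale (inf_tensor I) (inf_tensor_ip I) (slice_space (V 0 j))"
    using V by (rule closed_subspace_slice_space)
  have "tensor_embed I m (elem_tensor ip I b m f) \<in> slice_space (V 0 j)"
    if m: "m \<ge> 1" and f: "\<forall>k<m. f k \<in> V k j" for m f
    unfolding slice_space_def
  proof (intro CollectI conjI ballI)
    show "tensor_embed I m (elem_tensor ip I b m f) \<in> inf_tensor I"
      using f VH by (intro tensor_embed_ell2 elem_tensor_ell2) auto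
    fix \<beta> assume \<beta>: "\<beta> \<in> inf_idx I"
    \<comment> \<open>The coordinates of the other factors at the tail of \<open>\<beta>\<close>;
      the value 0 covers tails that the embedding does not reach. Since \<open>m \<ge> 1\<close>,
      overwriting slot 0 does not affect the condition on \<open>n \<ge> m\<close>.\<close>
    define c where "c = (if \<forall>n\<ge>m. \<beta> n = 0 then \<Prod>k\<in>{..<m} - {0}. ip k (f k) (b k (\<beta> k)) else 0)"
    have f0: "f 0 \<in> V 0 j" "f 0 \<in> H 0" using f m VH by force+
    have "ip 0 (scale c (f 0)) (b 0 i) =
        tensor_embed I m (elem_tensor ip I b m f) (\<beta>(0 := i))" if i: "i \<in> I 0" for i
    proof -
      let ?\<alpha> = "\<beta>(0 := i)"
      have \<alpha>: "?\<alpha> \<in> inf_idx I" using \<beta> i by (rule inf_idx_upd)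
      have "(\<Prod>k<m. ip k (f k) (b k (?\<alpha> k))) =
          ip 0 (f 0) (b 0 i) * (\<Prod>k\<in>{..<m} - {0}. ip k (f k) (b k (?\<alpha> k)))"
        using m by (subst prod.remove[of _ 0]) auto
      also have "(\<Prod>k\<in>{..<m} - {0}. ip k (f k) (b k (?\<alpha> k))) =
          (\<Prod>k\<in>{..<m} - {0}. ip k (f k) (b k (\<beta> k)))"
        by (rule prod.cong) auto
      finally have "tensor_embed I m (elem_tensor ip I b m f) ?\<alpha> = c * ip 0 (f 0) (b 0 i)"
        using \<alpha> m by (auto simp: tensor_embed_def elem_tensor_def c_def inf_idx_def fin_idx_def)
      then show ?thesis using f0 i basis_in_H by (simp add: factor.ip_scale)
    qed
    moreover have "scale c (f 0) \<in> V 0 j"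
      using f0 V[of 0] by (simp add: factor.closed_subspace_iff factor.subspace_scale)
    ultimately show "\<exists>v\<in>V 0 j. \<forall>i\<in>I 0. ip 0 v (b 0 i) =
        tensor_embed I m (elem_tensor ip I b m f) (\<beta>(0 := i))" by blast
  qed
  then have "V_fin ip I b V m j \<subseteq> slice_space (V 0 j)" if "m \<ge> 1" for m
    using that VH by (simp add: V_fin_subset_iff[OF C])
  then show ?thesis
    unfolding V_inf_def by (intro whole.closed_span_minimal C) auto
qed

section \<open>Trivial intersection and density\<close>

lemma Inter_V_inf:
  assumes V: "\<And>k j. closed_subspace scale (H k) (ip k) (V k j)" and triv: "(\<Inter>j. V 0 j) = {0}"
  shows "(\<Inter>j. V_inf ip I b V j) = {0}"
proof (intro equalityI subsetI)
  fix x assume "x \<in> {0 :: (nat \<Rightarrow> nat) \<Rightarrow> 'k}"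
  moreover have "0 \<in> V_inf ip I b V j" for j
    using closed_subspace_V_inf[of V j] whole.subspace_0 unfolding closed_subspace_def by metis
  ultimately show "x \<in> (\<Inter>j. V_inf ip I b V j)" by blast
next
  fix x assume "x \<in> (\<Inter>j. V_inf ip I b V j)"
  then have x: "x \<in> slice_space (V 0 j)" for j
    using V_inf_subset_slice_space[of V j, OF V] by blast
  have VH: "V 0 j \<subseteq> H 0" for j using V by (simp add: factor.closed_subspace_iff)
  have "x \<alpha> = 0" for \<alpha>
  proof (cases "\<alpha> \<in> inf_idx I")
    case True
    then have "\<forall>j. \<exists>v\<in>V 0 j. \<forall>i\<in>I 0. ip 0 v (b 0 i) = x (\<alpha>(0 := i))"
      using x unfolding slice_space_def by blast
    then obtain v where v: "\<And>j. v j \<in> V 0 j" "\<And>j i. i \<in> I 0 \<Longrightarrow> ip 0 (v j) (b 0 i) = x (\<alpha>(0 := i))"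
      by metis
    \<comment> \<open>The choice of \<open>v j\<close> depends on \<open>j\<close>, but the
      prescribed coordinates do not; so one vector lies in every \<open>V 0 j\<close>.\<close>
    have "v j = v 0" for j
    proof (rule factor.eq_if_coordinates[OF basis])
      show "v j \<in> H 0" "v 0 \<in> H 0" using v(1) VH by blast+
      show "ip 0 (v j) (b 0 i) = ip 0 (v 0) (b 0 i)" if "i \<in> I 0" for i
        using v(2)[OF that] by simp
    qed
    then have "v 0 \<in> V 0 j" for j using v(1)[of j] by metis
    then have "v 0 \<in> (\<Inter>j. V 0 j)" by blast
    then have "v 0 = 0" using triv by blast
    moreover have i: "\<alpha> 0 \<in> I 0" using True by (simp add: inf_idx_def)
    ultimately show ?thesis using v(2)[OF i, of 0] basis_in_H[OF i] by simp
  next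
    case False
    then show ?thesis using x[of 0] by (simp add: slice_space_def ell2_def)
  qed
  then show "x \<in> {0}" by (simp add: fun_eq_iff)
qed

lemma closure_Union_V_inf:
  assumes V: "\<And>k j. V k j \<subseteq> H k" and mono: "\<And>k. mono (V k)"
    and dense: "\<And>k. htop (H k) (ip k) closure_of (\<Union>j. V k j) = H k"
  shows "htop (inf_tensor I) (inf_tensor_ip I) closure_of (\<Union>j. V_inf ip I b V j) = inf_tensor I"
    (is "?D = _")
proof
  have V_mono: "mono (V_inf ip I b V)"
    by (intro monoI V_inf_subset_mono monoD[OF mono])
  have D: "closed_subspace fscale (inf_tensor I) (inf_tensor_ip I) ?D"
    using closed_subspace_V_inf
    by (intro closed_subspace_Union_chain V_mono) (simp add: closed_subspace_def)
  then show "?D \<subseteq> inf_tensor I" by (simp add: whole.closed_subspace_iff)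
  have VD: "V_inf ip I b V j \<subseteq> ?D" for j
  proof -
    have "V_inf ip I b V i \<subseteq> inf_tensor I" for i
      using closed_subspace_V_inf by (simp add: whole.closed_subspace_iff)
    then have "(\<Union>j. V_inf ip I b V j) \<subseteq> ?D" by (intro closure_of_subset) auto
    then show ?thesis by blast
  qed
  let ?u = "\<lambda>\<alpha> \<beta>. (if \<beta> = \<alpha> then 1 else 0) :: 'k"
  have "?u \<alpha> \<in> ?D" if \<alpha>: "\<alpha> \<in> inf_idx I" for \<alpha>
  proof -
    obtain N where "\<And>n. n \<ge> N \<Longrightarrow> \<alpha> n = 0"
      using \<alpha> by (auto simp: inf_idx_def eventually_sequentially)
    \<comment> \<open>Passing to \<open>Suc N\<close> ensures at least one slot, as the generators
      of \<open>V_inf\<close> require.\<close>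
    then have "\<alpha> n = 0" if "n \<ge> Suc N" for n using that by simp
    then obtain m where m: "m \<ge> 1" "\<And>n. n \<ge> m \<Longrightarrow> \<alpha> n = 0"
      using that[of "Suc N"] by simp
    let ?\<beta> = "restrict \<alpha> {..<m}"
    have \<beta>: "?\<beta> \<in> fin_idx I m" using \<alpha> by (auto simp: fin_idx_def inf_idx_def)
    have UD: "tensor_embed I m (elem_tensor ip I b m f) \<in> ?D"
      if f: "\<And>k. k < m \<Longrightarrow> f k \<in> (\<Union>j. V k j)" for f
    proof -
      \<comment> \<open>Each factor has its own level; the maximum of these finitely many levels
        serves all slots.\<close>
      have "\<forall>k. \<exists>j. k < m \<longrightarrow> f k \<in> V k j" using f by blast
      then obtain J where J: "\<And>k. k < m \<Longrightarrow> f k \<in> V k (J k)" by metis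
      have "f k \<in> V k (Max (J ` {..<m}))" if "k < m" for k
        using J[OF that] monoD[OF mono[of k], of "J k" "Max (J ` {..<m})"] that by auto
      then have "tensor_embed I m (elem_tensor ip I b m f) \<in> V_inf ip I b V (Max (J ` {..<m}))"
        by (intro elem_tensor_in_V_inf V m(1))
      then show ?thesis using VD by blast
    qed
    have bH: "b k (?\<beta> k) \<in> H k" if "k < m" for k
      using that \<alpha> basis_in_H by (simp add: inf_idx_def)
    have UH: "(\<Union>j. V k j) \<subseteq> H k" for k using V by blast
    \<comment> \<open>A basis vector is an elementary tensor of basis vectors, to which the exchange
      of factors applies with the dense unions as \<open>U k\<close>.\<close>
    have "tensor_embed I m (elem_tensor ip I b m (\<lambda>k. b k (?\<beta> k))) \<in> ?D"
      by (rule elem_tensor_in_closed[OF D dense UH]) (fact UD bH)+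
    then show ?thesis
      using elem_tensor_basis[OF basis \<beta>] tensor_embed_unit[of \<alpha> I m, where 'a = 'k] \<alpha> m(2)
      by simp
  qed
  then have "closed_span fscale (inf_tensor I) (inf_tensor_ip I) (?u ` inf_idx I) \<subseteq> ?D"
    by (intro whole.closed_span_minimal D) auto
  then show "inf_tensor I \<subseteq> ?D"
    using orthonormal_basis_ell2[of "inf_idx I", where 'k = 'k] by (simp add: orthonormal_basis_def)
qed

end

theorem theorem6p1:
  fixes scale :: "'k::rc_field \<Rightarrow> 'a::ab_group_add \<Rightarrow> 'a"
    and H :: "nat \<Rightarrow> 'a set"
    and ip :: "nat \<Rightarrow> 'a \<Rightarrow> 'a \<Rightarrow> 'k"
    and e :: "nat \<Rightarrow> 'a"
    and I :: "nat \<Rightarrow> nat set"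
    and b :: "nat \<Rightarrow> nat \<Rightarrow> 'a"
    and V :: "nat \<Rightarrow> int \<Rightarrow> 'a set"
  assumes hilbert: "\<And>n. hilbert_space scale (H n) (ip n)"
    and separable: "\<And>n. separable_space (htop (H n) (ip n))"
    and stabilizing: "\<And>n. e n \<in> H n" "\<And>n. hnorm (ip n) (e n) = 1"
    and basis: "\<And>n. orthonormal_basis scale (H n) (ip n) (I n) (b n)"
    and basis_e: "\<And>n. 0 \<in> I n" "\<And>n. b n 0 = e n"
    and closed: "\<And>n j. closed_subspace scale (H n) (ip n) (V n j)"
    and nested: "\<And>n j. V n j \<subseteq> V n (j + 1)"
    and dense: "\<And>n. htop (H n) (ip n) closure_of (\<Union>j. V n j) = H n"
    and trivial: "\<And>n. (\<Inter>j. V n j) = {0}"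
  shows "(\<forall>j. V_inf ip I b V j \<subseteq> V_inf ip I b V (j + 1)) \<and>
    htop (inf_tensor I) (inf_tensor_ip I) closure_of (\<Union>j. V_inf ip I b V j) = inf_tensor I \<and>
    (\<Inter>j. V_inf ip I b V j) = {0}"
proof -
  interpret tensor_factors scale H ip I b
    by (rule tensor_factors.intro) (fact hilbert basis basis_e(1))+
  have VH: "V n j \<subseteq> H n" for n j
    using closed by (simp add: factor.closed_subspace_iff)
  have mono: "mono (V n)" for n
  proof (rule monoI)
    show "V n i \<subseteq> V n j" if "i \<le> j" for i j
      using that by (induction j rule: int_ge_induct) (use nested in blast)+
  qed
  show ?thesis
    using V_inf_subset_mono nested closure_Union_V_inf[OF VH mono dense]
      Inter_V_inf[OF closed trivial] by simp
qed

end
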